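(* The class $\mathfrak{H}^{L}$ of all Lipschitz Hilbert operators, equipped with $\mathbf{H}^{L}$, is a strongly Lipschitz normed nonlinear ideal.
   Context: All Banach spaces are over a common scalar field $\mathbb{K}$ ($\mathbb{R}$ or $\mathbb{C}$). All metric spaces are pointed, with base point denoted $0$; a Banach space is pointed by its zero vector. For pointed metric spaces $X,Y$, $Lip(X,Y)$ is the set of all Lipschitz maps $T:X\to Y$ with $T(0)=0$, and $Lip(T)$ is the Lipschitz constant of $T$. $X^{\#}=Lip(X,\mathbb{K})$. For Banach spaces $E,F$, $\mathfrak{L}(E,F)$ is the space of bounded linear operators. For $g\in X^{\#}$ and $e\in F$, $g\boxtimes e\in Lip(X,F)$ is the map $x\mapsto g(x)e$. A nonlinear ideal $\mathcal{A}^{L}$ assigns to every pointed metric space $X$ and Banach space $F$ a subset $\mathcal{A}^{L}(X,F)\subseteq Lip(X,F)$ such that: (i) $g\boxtimes e\in\mathcal{A}^{L}(X,F)$ for all $g\in X^{\#}$, $e\in F$; (ii) $S+T\in\mathcal{A}^{L}(X,F)$ for all $S,T\in\mathcal{A}^{L}(X,F)$; (iii) $BTA\in\mathcal{A}^{L}(X_{0},F_{0})$ for all $A\in Lip(X_{0},X)$, $T\in\mathcal{A}^{L}(X,F)$, $B\in\mathfrak{L}(F,F_{0})$. A strongly Lipschitz normed nonlinear ideal $[\mathcal{A}^{L},\mathbf{A}^{L}]$ is a nonlinear ideal $\mathcal{A}^{L}$ with a map $\mathbf{A}^{L}:\mathcal{A}^{L}\to[0,\infty)$ such that: (a) $\mathbf{A}^{L}(g\boxtimes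 e)\le Lip(g)\|e\|$ for $g\in X^{\#}$, $e\in F$; (b) $\mathbf{A}^{L}(S+T)\le\mathbf{A}^{L}(S)+\mathbf{A}^{L}(T)$ for $S,T\in\mathcal{A}^{L}(X,F)$; (c) $\mathbf{A}^{L}(BTA)\le\|B\|\,\mathbf{A}^{L}(T)\,Lip(A)$ for $A\in Lip(X_{0},X)$, $T\in\mathcal{A}^{L}(X,F)$, $B\in\mathfrak{L}(F,F_{0})$. A Lipschitz operator $T\in Lip(X,F)$ is a Lipschitz Hilbert operator if $T=BA$ with $A\in Lip(X,H)$ and $B\in\mathfrak{L}(H,F)$ for some Hilbert space $H$. Put $\mathbf{H}^{L}(T):=\inf\|B\|\,Lip(A)$, the infimum over all such factorizations. *)

theory Defs
  imports "HOL-Analysis.Analysis" "HOL-Algebra.Module"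
begin

text \<open>
  All structures are carrier based, so that one can quantify over all metric spaces with points
  in \<open>'a\<close> and all Banach spaces with vectors in \<open>'b\<close>; the types \<open>'a\<close> and \<open>'b\<close> play the role of
  universes and stay arbitrary. A map between two such spaces is an extensional function on the
  carrier of its domain, so HOL equality of maps is equality of maps between the spaces.

  The scalar field is a subset \<open>K\<close> of the complex numbers, namely \<open>\<real>\<close> or the whole of \<open>UNIV\<close>.
\<close>

section \<open>Normed, Banach and Hilbert spaces over \<open>K\<close>\<close>

definition scalar_ring :: "complex set \<Rightarrow> complex ring" where
  "scalar_ring K = \<lparr>carrier = K, mult = (*), one = 1, zero = 0, add = (+)\<rparr>"

text \<open>The ring multiplication and unit inherited from the library's module record are never used.\<close>

record 'b normed_space = "(complex, 'b) module" +
  vnorm :: "'b \<Rightarrow> real"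

definition normed_vs :: "complex set \<Rightarrow> 'b normed_space \<Rightarrow> bool" where
  "normed_vs K F \<longleftrightarrow>
     Module.module (scalar_ring K) F \<and>
     (\<forall>x\<in>carrier F. 0 \<le> vnorm F x) \<and>
     (\<forall>x\<in>carrier F. vnorm F x = 0 \<longrightarrow> x = \<zero>\<^bsub>F\<^esub>) \<and>
     (\<forall>c\<in>K. \<forall>x\<in>carrier F. vnorm F (c \<odot>\<^bsub>F\<^esub> x) = cmod c * vnorm F x) \<and>
     (\<forall>x\<in>carrier F. \<forall>y\<in>carrier F. vnorm F (x \<oplus>\<^bsub>F\<^esub> y) \<le> vnorm F x + vnorm F y)"

text \<open>The library's metric spaces require a symmetric, nonnegative distance even off the carrier.\<close>

definition vdist :: "'b normed_space \<Rightarrow> 'b \<Rightarrow> 'b \<Rightarrow> real" where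
  "vdist F x y = (if x \<in> carrier F \<and> y \<in> carrier F then vnorm F (x \<ominus>\<^bsub>F\<^esub> y) else 0)"

definition banach_vs :: "complex set \<Rightarrow> 'b normed_space \<Rightarrow> bool" where
  "banach_vs K F \<longleftrightarrow> normed_vs K F \<and> Metric_space.mcomplete (carrier F) (vdist F)"

definition inner_product_on ::
    "complex set \<Rightarrow> 'b normed_space \<Rightarrow> ('b \<Rightarrow> 'b \<Rightarrow> complex) \<Rightarrow> bool" where
  "inner_product_on K H ip \<longleftrightarrow>
     (\<forall>x\<in>carrier H. \<forall>y\<in>carrier H. ip x y \<in> K \<and> ip y x = cnj (ip x y)) \<and>
     (\<forall>x\<in>carrier H. \<forall>y\<in>carrier H. \<forall>z\<in>carrier H. ip (x \<oplus>\<^bsub>H\<^esub> y) z = ip x z + ip y z) \<and>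
     (\<forall>c\<in>K. \<forall>x\<in>carrier H. \<forall>y\<in>carrier H. ip (c \<odot>\<^bsub>H\<^esub> x) y = c * ip x y) \<and>
     (\<forall>x\<in>carrier H. 0 \<le> Re (ip x x) \<and> (ip x x = 0 \<longrightarrow> x = \<zero>\<^bsub>H\<^esub>))"

definition hilbert_vs :: "complex set \<Rightarrow> 'b normed_space \<Rightarrow> bool" where
  "hilbert_vs K H \<longleftrightarrow>
     banach_vs K H \<and>
     (\<exists>ip. inner_product_on K H ip \<and> (\<forall>x\<in>carrier H. vnorm H x = sqrt (Re (ip x x))))"

definition bounded_ops ::
    "complex set \<Rightarrow> 'b normed_space \<Rightarrow> 'c normed_space \<Rightarrow> ('b \<Rightarrow> 'c) set" where
  "bounded_ops K E F =
     {B \<in> carrier E \<rightarrow>\<^sub>E carrier F.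
        (\<forall>x\<in>carrier E. \<forall>y\<in>carrier E. B (x \<oplus>\<^bsub>E\<^esub> y) = B x \<oplus>\<^bsub>F\<^esub> B y) \<and>
        (\<forall>c\<in>K. \<forall>x\<in>carrier E. B (c \<odot>\<^bsub>E\<^esub> x) = c \<odot>\<^bsub>F\<^esub> B x) \<and>
        (\<exists>C. \<forall>x\<in>carrier E. vnorm F (B x) \<le> C * vnorm E x)}"

definition opnorm :: "'b normed_space \<Rightarrow> 'c normed_space \<Rightarrow> ('b \<Rightarrow> 'c) \<Rightarrow> real" where
  "opnorm E F B = (SUP x\<in>{x \<in> carrier E. vnorm E x \<le> 1}. vnorm F (B x))"


section \<open>Pointed metric spaces and Lipschitz maps\<close>

type_synonym 'a pointed = "'a metric \<times> 'a"

definition pointed_metric :: "'a pointed \<Rightarrow> bool" where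
  "pointed_metric X \<longleftrightarrow> snd X \<in> mspace (fst X)"

abbreviation points :: "'a pointed \<Rightarrow> 'a set" where
  "points X \<equiv> mspace (fst X)"

definition pointed_vs :: "'b normed_space \<Rightarrow> 'b pointed" where
  "pointed_vs F = (metric (carrier F, vdist F), \<zero>\<^bsub>F\<^esub>)"

definition pointed_scalars :: "complex set \<Rightarrow> complex pointed" where
  "pointed_scalars K = (submetric euclidean_metric K, 0)"

definition Lip :: "'a pointed \<Rightarrow> 'c pointed \<Rightarrow> ('a \<Rightarrow> 'c) set" where
  "Lip X Y =
     {T \<in> points X \<rightarrow>\<^sub>E points Y.
        Lipschitz_continuous_map (fst X) (fst Y) T \<and> T (snd X) = snd Y}"

definition lip_const :: "'a pointed \<Rightarrow> 'c pointed \<Rightarrow> ('a \<Rightarrow> 'c) \<Rightarrow> real" where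
  "lip_const X Y T =
     Inf {C. 0 \<le> C \<and>
             (\<forall>x\<in>points X. \<forall>y\<in>points X. mdist (fst Y) (T x) (T y) \<le> C * mdist (fst X) x y)}"

definition lip_dual :: "complex set \<Rightarrow> 'a pointed \<Rightarrow> ('a \<Rightarrow> complex) set" where
  "lip_dual K X = Lip X (pointed_scalars K)"

definition rank_one :: "'a pointed \<Rightarrow> 'b normed_space \<Rightarrow> ('a \<Rightarrow> complex) \<Rightarrow> 'b \<Rightarrow> 'a \<Rightarrow> 'b" where
  "rank_one X F g e = (\<lambda>x\<in>points X. g x \<odot>\<^bsub>F\<^esub> e)"

definition pointwise_add :: "'a pointed \<Rightarrow> 'b normed_space \<Rightarrow> ('a \<Rightarrow> 'b) \<Rightarrow> ('a \<Rightarrow> 'b) \<Rightarrow> 'a \<Rightarrow> 'b" where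
  "pointwise_add X F S T = (\<lambda>x\<in>points X. S x \<oplus>\<^bsub>F\<^esub> T x)"


section \<open>Nonlinear ideals\<close>

type_synonym ('a, 'b) operator_class = "'a pointed \<Rightarrow> 'b normed_space \<Rightarrow> ('a \<Rightarrow> 'b) set"

definition nonlinear_ideal :: "complex set \<Rightarrow> ('a, 'b) operator_class \<Rightarrow> bool" where
  "nonlinear_ideal K \<A> \<longleftrightarrow>
     (\<forall>X F. pointed_metric X \<and> banach_vs K F \<longrightarrow>
        \<A> X F \<subseteq> Lip X (pointed_vs F) \<and>
        (\<forall>g\<in>lip_dual K X. \<forall>e\<in>carrier F. rank_one X F g e \<in> \<A> X F) \<and>
        (\<forall>S\<in>\<A> X F. \<forall>T\<in>\<A> X F. pointwise_add X F S T \<in> \<A> X F)) \<and>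
     (\<forall>X\<^sub>0 X F F\<^sub>0.
        pointed_metric X\<^sub>0 \<and> pointed_metric X \<and> banach_vs K F \<and> banach_vs K F\<^sub>0 \<longrightarrow>
        (\<forall>A\<in>Lip X\<^sub>0 X. \<forall>T\<in>\<A> X F. \<forall>B\<in>bounded_ops K F F\<^sub>0.
           compose (points X\<^sub>0) B (compose (points X\<^sub>0) T A) \<in> \<A> X\<^sub>0 F\<^sub>0))"

definition strongly_lipschitz_normed_ideal ::
    "complex set \<Rightarrow> ('a, 'b) operator_class \<Rightarrow>
     ('a pointed \<Rightarrow> 'b normed_space \<Rightarrow> ('a \<Rightarrow> 'b) \<Rightarrow> real) \<Rightarrow> bool" where
  "strongly_lipschitz_normed_ideal K \<A> N \<longleftrightarrow>
     nonlinear_ideal K \<A> \<and>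
     (\<forall>X F. pointed_metric X \<and> banach_vs K F \<longrightarrow>
        (\<forall>T\<in>\<A> X F. 0 \<le> N X F T) \<and>
        (\<forall>g\<in>lip_dual K X. \<forall>e\<in>carrier F.
           N X F (rank_one X F g e) \<le> lip_const X (pointed_scalars K) g * vnorm F e) \<and>
        (\<forall>S\<in>\<A> X F. \<forall>T\<in>\<A> X F. N X F (pointwise_add X F S T) \<le> N X F S + N X F T)) \<and>
     (\<forall>X\<^sub>0 X F F\<^sub>0.
        pointed_metric X\<^sub>0 \<and> pointed_metric X \<and> banach_vs K F \<and> banach_vs K F\<^sub>0 \<longrightarrow>
        (\<forall>A\<in>Lip X\<^sub>0 X. \<forall>T\<in>\<A> X F. \<forall>B\<in>bounded_ops K F F\<^sub>0.
           N X\<^sub>0 F\<^sub>0 (compose (points X\<^sub>0) B (compose (points X\<^sub>0) T A))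
             \<le> opnorm F F\<^sub>0 B * N X F T * lip_const X\<^sub>0 X A))"


section \<open>Lipschitz Hilbert operators\<close>

definition hilbert_factorization ::
    "complex set \<Rightarrow> 'a pointed \<Rightarrow> 'b normed_space \<Rightarrow> ('a \<Rightarrow> 'b) \<Rightarrow>
     'h normed_space \<Rightarrow> ('a \<Rightarrow> 'h) \<Rightarrow> ('h \<Rightarrow> 'b) \<Rightarrow> bool" where
  "hilbert_factorization K X F T H A B \<longleftrightarrow>
     hilbert_vs K H \<and> A \<in> Lip X (pointed_vs H) \<and> B \<in> bounded_ops K H F \<and>
     T = compose (points X) B A"

text \<open>
  A definition cannot quantify over types, so the Hilbert spaces are taken with vectors in
  \<open>'a \<Rightarrow> complex\<close>. This loses nothing: by the lemma \<open>hilbert_factorization_any_type\<close> below, a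
  factorization through a Hilbert space over any type at all yields one of this form whose
  cost \<open>\<parallel>B\<parallel> Lip(A)\<close> is not larger.
\<close>

definition hilbert_ops :: "complex set \<Rightarrow> ('a, 'b) operator_class" where
  "hilbert_ops K X F =
     {T \<in> Lip X (pointed_vs F).
        \<exists>(H :: ('a \<Rightarrow> complex) normed_space) A B. hilbert_factorization K X F T H A B}"

definition hilbert_op_norm ::
    "complex set \<Rightarrow> 'a pointed \<Rightarrow> 'b normed_space \<Rightarrow> ('a \<Rightarrow> 'b) \<Rightarrow> real" where
  "hilbert_op_norm K X F T =
     Inf {opnorm H F B * lip_const X (pointed_vs H) A |
            (H :: ('a \<Rightarrow> complex) normed_space) A B. hilbert_factorization K X F T H A B}"


section \<open>Hilbert spaces over an arbitrary type give nothing new\<close>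

lemma scalar_ring_simps [simp]:
  "carrier (scalar_ring K) = K" "add (scalar_ring K) = (+)" "mult (scalar_ring K) = (*)"
  "zero (scalar_ring K) = 0" "one (scalar_ring K) = 1"
  by (simp_all add: scalar_ring_def)

locale normed_vs_loc = Module.module "scalar_ring K" H for K and H :: "'h normed_space" +
  assumes K: "K = \<real> \<or> K = UNIV"
    and normed: "normed_vs K H"
begin

lemma K_closed [simp]:
  "0 \<in> K" "1 \<in> K" "complex_of_real r \<in> K"
  "a \<in> K \<Longrightarrow> - a \<in> K" "a \<in> K \<Longrightarrow> b \<in> K \<Longrightarrow> a + b \<in> K" "a \<in> K \<Longrightarrow> b \<in> K \<Longrightarrow> a * b \<in> K"
  using K by auto

lemma vnorm_nonneg: "x \<in> carrier H \<Longrightarrow> 0 \<le> vnorm H x"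
  and vnorm_zeroD: "x \<in> carrier H \<Longrightarrow> vnorm H x = 0 \<Longrightarrow> x = \<zero>\<^bsub>H\<^esub>"
  and vnorm_smult: "c \<in> K \<Longrightarrow> x \<in> carrier H \<Longrightarrow> vnorm H (c \<odot>\<^bsub>H\<^esub> x) = cmod c * vnorm H x"
  and vnorm_triangle: "x \<in> carrier H \<Longrightarrow> y \<in> carrier H \<Longrightarrow>
    vnorm H (x \<oplus>\<^bsub>H\<^esub> y) \<le> vnorm H x + vnorm H y"
  using normed by (auto simp: normed_vs_def)

lemma uminus_eq: assumes x: "x \<in> carrier H" shows "\<ominus>\<^bsub>H\<^esub> x = (-1) \<odot>\<^bsub>H\<^esub> x"
proof (rule M.minus_equality)
  have "(-1) \<odot>\<^bsub>H\<^esub> x \<oplus>\<^bsub>H\<^esub> x = (-1) \<odot>\<^bsub>H\<^esub> x \<oplus>\<^bsub>H\<^esub> 1 \<odot>\<^bsub>H\<^esub> x"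
    using smult_one x by simp
  also have "\<dots> = (-1 + 1) \<odot>\<^bsub>H\<^esub> x"
    using smult_l_distr[of "-1" 1 x] x by simp
  also have "\<dots> = \<zero>\<^bsub>H\<^esub>"
    using smult_l_null x by simp
  finally show "(-1) \<odot>\<^bsub>H\<^esub> x \<oplus>\<^bsub>H\<^esub> x = \<zero>\<^bsub>H\<^esub>" .
  show "(-1) \<odot>\<^bsub>H\<^esub> x \<in> carrier H"
    using smult_closed[of "-1" x] x by simp
qed (rule x)

lemma smult_in [simp]: "c \<in> K \<Longrightarrow> x \<in> carrier H \<Longrightarrow> c \<odot>\<^bsub>H\<^esub> x \<in> carrier H"
  using smult_closed by simp

lemma diff_eq: "x \<in> carrier H \<Longrightarrow> y \<in> carrier H \<Longrightarrow> x \<ominus>\<^bsub>H\<^esub> y = x \<oplus>\<^bsub>H\<^esub> (-1) \<odot>\<^bsub>H\<^esub> y"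
  by (simp add: a_minus_def uminus_eq)

lemma diff_zero_iff: assumes "x \<in> carrier H" "y \<in> carrier H"
  shows "x \<ominus>\<^bsub>H\<^esub> y = \<zero>\<^bsub>H\<^esub> \<longleftrightarrow> x = y"
proof
  assume "x \<ominus>\<^bsub>H\<^esub> y = \<zero>\<^bsub>H\<^esub>"
  then have "\<ominus>\<^bsub>H\<^esub> (\<ominus>\<^bsub>H\<^esub> y) = x"
    using assms by (intro M.minus_equality) (auto simp: a_minus_def)
  then show "x = y"
    using assms by simp
qed (use assms M.r_neg in \<open>simp add: a_minus_def\<close>)

lemma vnorm_zero: "vnorm H \<zero>\<^bsub>H\<^esub> = 0"
  using vnorm_smult[of 0 "\<zero>\<^bsub>H\<^esub>"] smult_l_null[of "\<zero>\<^bsub>H\<^esub>"] by simp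

lemma metric_space: "Metric_space (carrier H) (vdist H)"
proof
  fix x y z
  show "0 \<le> vdist H x y"
    by (simp add: vdist_def vnorm_nonneg)
  show "vdist H x y = vdist H y x"
  proof (cases "x \<in> carrier H \<and> y \<in> carrier H")
    case True
    have "vnorm H (y \<ominus>\<^bsub>H\<^esub> x) = vnorm H ((-1) \<odot>\<^bsub>H\<^esub> (x \<ominus>\<^bsub>H\<^esub> y))"
      using True by (simp add: uminus_eq[symmetric] M.minus_add M.a_comm a_minus_def)
    then show ?thesis
      using True vnorm_smult[of "-1" "x \<ominus>\<^bsub>H\<^esub> y"] by (simp add: vdist_def)
  qed (auto simp: vdist_def)
  show "vdist H x y = 0 \<longleftrightarrow> x = y" if "x \<in> carrier H" "y \<in> carrier H"
    using that vnorm_zeroD[of "x \<ominus>\<^bsub>H\<^esub> y"] vnorm_zero diff_zero_iff[of x y]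
    unfolding vdist_def by force
  show "vdist H x z \<le> vdist H x y + vdist H y z"
    if "x \<in> carrier H" "y \<in> carrier H" "z \<in> carrier H"
  proof -
    have "x \<ominus>\<^bsub>H\<^esub> z = (x \<ominus>\<^bsub>H\<^esub> y) \<oplus>\<^bsub>H\<^esub> (y \<ominus>\<^bsub>H\<^esub> z)"
      using that by (simp add: a_minus_def M.a_assoc M.r_neg1)
    then show ?thesis
      using that vnorm_triangle[of "x \<ominus>\<^bsub>H\<^esub> y" "y \<ominus>\<^bsub>H\<^esub> z"] by (simp add: vdist_def)
  qed
qed

lemma pointed_vs_simps [simp]:
  "mspace (fst (pointed_vs H)) = carrier H" "mdist (fst (pointed_vs H)) = vdist H"
  "snd (pointed_vs H) = \<zero>\<^bsub>H\<^esub>"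
  using metric_space by (auto simp: pointed_vs_def Metric_space.mspace_metric Metric_space.mdist_metric)

end

lemma normed_vs_locI: "K = \<real> \<or> K = UNIV \<Longrightarrow> normed_vs K H \<Longrightarrow> normed_vs_loc K H"
  by (simp add: normed_vs_loc_def normed_vs_loc_axioms_def normed_vs_def)

locale hilbert_ip = normed_vs_loc K H for K and H :: "'h normed_space" +
  fixes ip
  assumes ip: "inner_product_on K H ip"
    and vnorm_ip: "x \<in> carrier H \<Longrightarrow> vnorm H x = sqrt (Re (ip x x))"
begin

lemma ip_in: "x \<in> carrier H \<Longrightarrow> y \<in> carrier H \<Longrightarrow> ip x y \<in> K"
  and ip_sym: "x \<in> carrier H \<Longrightarrow> y \<in> carrier H \<Longrightarrow> ip y x = cnj (ip x y)"
  and ip_add: "x \<in> carrier H \<Longrightarrow> y \<in> carrier H \<Longrightarrow> z \<in> carrier H \<Longrightarrow>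
    ip (x \<oplus>\<^bsub>H\<^esub> y) z = ip x z + ip y z"
  and ip_smult: "c \<in> K \<Longrightarrow> x \<in> carrier H \<Longrightarrow> z \<in> carrier H \<Longrightarrow> ip (c \<odot>\<^bsub>H\<^esub> x) z = c * ip x z"
  and ip_nonneg: "x \<in> carrier H \<Longrightarrow> 0 \<le> Re (ip x x)"
  and ip_zeroD: "x \<in> carrier H \<Longrightarrow> ip x x = 0 \<Longrightarrow> x = \<zero>\<^bsub>H\<^esub>"
  using ip unfolding inner_product_on_def by blast+

lemma ip_add_r: assumes "x \<in> carrier H" "y \<in> carrier H" "z \<in> carrier H"
  shows "ip z (x \<oplus>\<^bsub>H\<^esub> y) = ip z x + ip z y"
  using assms ip_sym[of z x] ip_sym[of z y] ip_sym[of z "x \<oplus>\<^bsub>H\<^esub> y"] ip_add[of x y z]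
  by (metis M.add.m_closed complex_cnj_add complex_cnj_cnj)

lemma ip_smult_r: assumes "c \<in> K" "x \<in> carrier H" "z \<in> carrier H"
  shows "ip z (c \<odot>\<^bsub>H\<^esub> x) = cnj c * ip z x"
  using assms ip_sym[of z x] ip_sym[of z "c \<odot>\<^bsub>H\<^esub> x"] ip_smult[of c x z]
  by (metis complex_cnj_cnj complex_cnj_mult smult_in)

lemma ip_diff: "x \<in> carrier H \<Longrightarrow> y \<in> carrier H \<Longrightarrow> z \<in> carrier H \<Longrightarrow>
    ip (x \<ominus>\<^bsub>H\<^esub> y) z = ip x z - ip y z"
  by (simp add: diff_eq ip_add ip_smult)

lemma ip_zero: "z \<in> carrier H \<Longrightarrow> ip \<zero>\<^bsub>H\<^esub> z = 0"
  using ip_add[of "\<zero>\<^bsub>H\<^esub>" "\<zero>\<^bsub>H\<^esub>" z] by simp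

lemma ip_self: "x \<in> carrier H \<Longrightarrow> ip x x = complex_of_real (Re (ip x x))"
  using ip_sym[of x x] by (simp add: complex_eq_iff)

lemma cauchy_schwarz:
  assumes x: "x \<in> carrier H" and y: "y \<in> carrier H"
  shows "cmod (ip x y) \<le> vnorm H x * vnorm H y"
proof (cases "y = \<zero>\<^bsub>H\<^esub>")
  case True
  then have "ip x y = 0"
    using ip_sym[OF y x] ip_zero[OF x] by simp
  then show ?thesis
    by (simp add: x y vnorm_nonneg)
next
  case False
  define a where "a = Re (ip y y)"
  define r where "r = Re (ip x x)"
  define b where "b = ip x y"
  have yy: "ip y y = of_real a" and xx: "ip x x = of_real r"
    using ip_self x y by (auto simp: a_def r_def)
  have "a \<noteq> 0"
    using False ip_zeroD[OF y] yy by auto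
  then have a: "a > 0"
    using ip_nonneg[OF y] by (simp add: a_def)
  have yx: "ip y x = cnj b"
    using ip_sym[OF x y] by (simp add: b_def)
  have b: "- b \<in> K"
    using ip_in x y by (simp add: b_def)
  define z where "z = of_real a \<odot>\<^bsub>H\<^esub> x \<oplus>\<^bsub>H\<^esub> (- b) \<odot>\<^bsub>H\<^esub> y"
  have z: "z \<in> carrier H"
    unfolding z_def using x y b by simp
  have "ip z z = of_real a * (of_real a * ip x x - cnj b * b)"
    unfolding z_def using x y b
    by (simp add: ip_add ip_smult ip_add_r ip_smult_r yy yx b_def[symmetric] algebra_simps)
  also have "\<dots> = of_real (a * (a * r - (cmod b)\<^sup>2))"
    by (simp add: xx complex_norm_square mult.commute del: of_real_power)
  finally have "0 \<le> a * (a * r - (cmod b)\<^sup>2)"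
    using ip_nonneg[OF z] by simp
  then have "(cmod b)\<^sup>2 \<le> r * a"
    using a by (simp add: zero_le_mult_iff mult.commute)
  then have "cmod b \<le> sqrt (r * a)"
    by (simp add: real_le_rsqrt)
  then show ?thesis
    by (simp add: vnorm_ip x y b_def a_def r_def real_sqrt_mult)
qed

end

text \<open>
  The Hilbert space is replaced by the closed linear span of \<open>A ` X\<close>, written as a double
  orthogonal complement, and a vector \<open>w\<close> of that span by the function \<open>x \<mapsto> \<langle>w, A x\<rangle>\<close>.
\<close>

lemma hilbert_factorization_any_type:
  fixes X :: "'a pointed" and F :: "'b normed_space" and H :: "'h normed_space"
  assumes K: "K = \<real> \<or> K = UNIV" and X: "pointed_metric X" and F: "banach_vs K F"
    and fac: "hilbert_factorization K X F T H A B"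
  shows "\<exists>(H' :: ('a \<Rightarrow> complex) normed_space) A' B'.
           hilbert_factorization K X F T H' A' B' \<and>
           opnorm H' F B' * lip_const X (pointed_vs H') A'
             \<le> opnorm H F B * lip_const X (pointed_vs H) A"
proof -
  have bH: "banach_vs K H" and nF: "normed_vs K F"
    using fac F by (auto simp: hilbert_factorization_def hilbert_vs_def banach_vs_def)
  obtain ip where ip: "inner_product_on K H ip" "\<forall>x\<in>carrier H. vnorm H x = sqrt (Re (ip x x))"
    using fac by (auto simp: hilbert_factorization_def hilbert_vs_def)
  interpret H: hilbert_ip K H ip
    unfolding hilbert_ip_def hilbert_ip_axioms_def
    using ip bH normed_vs_locI[OF K] by (auto simp: banach_vs_def)
  interpret F: normed_vs_loc K F
    by (rule normed_vs_locI[OF K nF])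
  interpret MH: Metric_space "carrier H" "vdist H"
    by (rule H.metric_space)
  define P where "P = points X"
  have A: "A \<in> P \<rightarrow>\<^sub>E carrier H" "Lipschitz_continuous_map (fst X) (fst (pointed_vs H)) A"
      "A (snd X) = \<zero>\<^bsub>H\<^esub>"
    using fac by (auto simp: hilbert_factorization_def Lip_def P_def)
  have Ax [simp]: "A x \<in> carrier H" if "x \<in> P" for x
    using A(1) that by auto
  have B: "B \<in> bounded_ops K H F" and TBA: "T = compose P B A"
    using fac by (auto simp: hilbert_factorization_def P_def)
  define W where "W = {w \<in> carrier H. \<forall>h\<in>carrier H. (\<forall>x\<in>P. ip h (A x) = 0) \<longrightarrow> ip w h = 0}"
  define \<phi> where "\<phi> w = (\<lambda>x. if x \<in> P then ip w (A x) else 0)" for w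
  define \<psi> where "\<psi> = inv_into W \<phi>"
  have W0 [simp]: "\<zero>\<^bsub>H\<^esub> \<in> W"
    by (simp add: W_def H.ip_zero)
  have Wadd [simp]: "u \<oplus>\<^bsub>H\<^esub> v \<in> W" if "u \<in> W" "v \<in> W" for u v
    using that by (simp add: W_def H.ip_add)
  have Wsm [simp]: "c \<odot>\<^bsub>H\<^esub> u \<in> W" if "c \<in> K" "u \<in> W" for c u
    using that by (simp add: W_def H.ip_smult)
  have WH [simp]: "w \<in> carrier H" if "w \<in> W" for w
    using that by (simp add: W_def)
  have Wdiff [simp]: "u \<ominus>\<^bsub>H\<^esub> v \<in> W" if "u \<in> W" "v \<in> W" for u v
    using that by (simp add: H.diff_eq)
  have AW [simp]: "A x \<in> W" if "x \<in> P" for x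
  proof -
    have "ip (A x) h = 0" if "h \<in> carrier H" "ip h (A x) = 0" for h
      using H.ip_sym[OF that(1) Ax[OF \<open>x \<in> P\<close>]] that(2) by simp
    then show ?thesis
      using that by (simp add: W_def del: WH)
  qed
  have inj: "inj_on \<phi> W"
  proof (rule inj_onI)
    fix u v assume uv: "u \<in> W" "v \<in> W" and eq: "\<phi> u = \<phi> v"
    have "ip (u \<ominus>\<^bsub>H\<^esub> v) (A x) = 0" if "x \<in> P" for x
      using fun_cong[OF eq, of x] that uv by (simp add: \<phi>_def H.ip_diff)
    then have "ip (u \<ominus>\<^bsub>H\<^esub> v) (u \<ominus>\<^bsub>H\<^esub> v) = 0"
      using Wdiff[OF uv] unfolding W_def by blast
    then have "u \<ominus>\<^bsub>H\<^esub> v = \<zero>\<^bsub>H\<^esub>"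
      using H.ip_zeroD uv by simp
    then show "u = v"
      using uv by (simp add: H.diff_zero_iff)
  qed
  have \<psi>\<phi> [simp]: "\<psi> (\<phi> w) = w" if "w \<in> W" for w
    using inj that by (simp add: \<psi>_def)
  define H' :: "('a \<Rightarrow> complex) normed_space" where
    "H' = \<lparr>carrier = \<phi> ` W, mult = (\<lambda>u v. u), one = \<phi> \<zero>\<^bsub>H\<^esub>, zero = \<phi> \<zero>\<^bsub>H\<^esub>,
           add = (\<lambda>u v. \<phi> (\<psi> u \<oplus>\<^bsub>H\<^esub> \<psi> v)), smult = (\<lambda>c u. \<phi> (c \<odot>\<^bsub>H\<^esub> \<psi> u)),
           vnorm = (\<lambda>u. vnorm H (\<psi> u))\<rparr>"
  have H' [simp]: "carrier H' = \<phi> ` W" "\<zero>\<^bsub>H'\<^esub> = \<phi> \<zero>\<^bsub>H\<^esub>"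
      "u \<oplus>\<^bsub>H'\<^esub> v = \<phi> (\<psi> u \<oplus>\<^bsub>H\<^esub> \<psi> v)" "c \<odot>\<^bsub>H'\<^esub> u = \<phi> (c \<odot>\<^bsub>H\<^esub> \<psi> u)"
      "vnorm H' u = vnorm H (\<psi> u)" for u v c
    by (simp_all add: H'_def)
  have ag: "abelian_group H'"
  proof (rule abelian_groupI)
    fix u assume "u \<in> carrier H'"
    then obtain w where w: "w \<in> W" "u = \<phi> w" by auto
    have "(-1) \<odot>\<^bsub>H\<^esub> w \<oplus>\<^bsub>H\<^esub> w = \<zero>\<^bsub>H\<^esub>"
      using w by (simp add: H.uminus_eq[symmetric] H.M.l_neg)
    then have "\<phi> ((-1) \<odot>\<^bsub>H\<^esub> w) \<oplus>\<^bsub>H'\<^esub> u = \<zero>\<^bsub>H'\<^esub>"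
      using w by simp
    then show "\<exists>v\<in>carrier H'. v \<oplus>\<^bsub>H'\<^esub> u = \<zero>\<^bsub>H'\<^esub>"
      using w by (metis H'(1) H.K_closed(2) H.K_closed(4) Wsm imageI)
  qed (auto simp: H.M.a_ac)
  have mod: "Module.module (scalar_ring K) H'"
    by (rule Module.moduleI[OF H.R.is_cring ag])
      (use H.smult_l_distr H.smult_r_distr H.smult_assoc1 H.smult_one in auto)
  have nH': "normed_vs K H'"
    unfolding normed_vs_def using mod H.vnorm_nonneg H.vnorm_zeroD H.vnorm_smult H.vnorm_triangle
    by (auto intro!: arg_cong[where f = \<phi>])
  interpret H': normed_vs_loc K H'
    by (rule normed_vs_locI[OF K nH'])
  interpret MH': Metric_space "carrier H'" "vdist H'"
    by (rule H'.metric_space)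
  have dist: "vdist H' (\<phi> u) (\<phi> v) = vdist H u v" if "u \<in> W" "v \<in> W" for u v
    using that by (simp add: vdist_def H.diff_eq H'.diff_eq)
  have "MH'.mcomplete"
    unfolding MH'.mcomplete_def
  proof (intro allI impI)
    fix s assume s: "MH'.MCauchy s"
    define t where "t n = \<psi> (s n)" for n
    have tW [simp]: "t n \<in> W" and st: "s n = \<phi> (t n)" for n
      using s unfolding MH'.MCauchy_def by (auto simp: t_def image_subset_iff) (metis \<psi>\<phi> image_iff)+
    have "MH.MCauchy t"
      using s unfolding MH'.MCauchy_def MH.MCauchy_def by (auto simp: st dist)
    then obtain l where l: "limitin MH.mtopology t l sequentially"
      using bH by (auto simp: banach_vs_def MH.mcomplete_def)
    have lH [simp]: "l \<in> carrier H"
      using l by (simp add: MH.limit_metric_sequentially)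
    have "ip l h = 0" if h: "h \<in> carrier H" "\<forall>x\<in>P. ip h (A x) = 0" for h
    proof (rule ccontr)
      assume ne: "ip l h \<noteq> 0"
      define e where "e = cmod (ip l h) / (vnorm H h + 1)"
      have pos: "vnorm H h + 1 > 0"
        using H.vnorm_nonneg[OF h(1)] by simp
      then have "e > 0"
        using ne by (simp add: e_def)
      then obtain n where n: "vdist H (t n) l < e"
        using l by (auto simp: MH.limit_metric_sequentially)
      have "ip (t n) h = 0"
        using tW[of n] h unfolding W_def by blast
      then have "cmod (ip l h) = cmod (ip (t n \<ominus>\<^bsub>H\<^esub> l) h)"
        using h by (simp add: H.ip_diff)
      also have "\<dots> \<le> vnorm H (t n \<ominus>\<^bsub>H\<^esub> l) * vnorm H h"
        using h by (intro H.cauchy_schwarz) auto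
      also have "\<dots> \<le> vnorm H (t n \<ominus>\<^bsub>H\<^esub> l) * (vnorm H h + 1)"
        by (intro mult_left_mono) (auto simp: H.vnorm_nonneg)
      also have "\<dots> < e * (vnorm H h + 1)"
        using n pos by (simp add: vdist_def)
      also have "\<dots> = cmod (ip l h)"
        using pos by (simp add: e_def)
      finally show False by simp
    qed
    then have lW: "l \<in> W"
      by (simp add: W_def del: WH)
    have "limitin MH'.mtopology s (\<phi> l) sequentially"
      using l lW unfolding MH'.limit_metric_sequentially MH.limit_metric_sequentially
      by (auto simp: st dist)
    then show "\<exists>x. limitin MH'.mtopology s x sequentially" by blast
  qed
  then have bH': "banach_vs K H'"
    using nH' by (simp add: banach_vs_def)
  have hH': "hilbert_vs K H'"
    unfolding hilbert_vs_def
  proof (intro conjI exI)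
    show "inner_product_on K H' (\<lambda>u v. ip (\<psi> u) (\<psi> v))"
      unfolding inner_product_on_def
    proof (intro conjI ballI impI)
      fix u v assume "u \<in> carrier H'" "v \<in> carrier H'"
      then have "\<psi> u \<in> W" "\<psi> v \<in> W" by auto
      then show "ip (\<psi> u) (\<psi> v) \<in> K" "ip (\<psi> v) (\<psi> u) = cnj (ip (\<psi> u) (\<psi> v))"
        using H.ip_in[of "\<psi> u" "\<psi> v"] H.ip_sym[of "\<psi> u" "\<psi> v"] WH by blast+
    qed (auto simp: H.ip_add H.ip_smult H.ip_nonneg intro!: arg_cong[where f = \<phi>] H.ip_zeroD)
    show "\<forall>u\<in>carrier H'. vnorm H' u = sqrt (Re (ip (\<psi> u) (\<psi> u)))"
      using H.vnorm_ip by simp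
  qed (rule bH')
  define A' where "A' = (\<lambda>x\<in>P. \<phi> (A x))"
  define B' where "B' = (\<lambda>u\<in>\<phi> ` W. B (\<psi> u))"
  have A'dist: "vdist H' (A' x) (A' y) = vdist H (A x) (A y)" if "x \<in> P" "y \<in> P" for x y
    using that by (simp add: A'_def dist)
  have lip: "lip_const X (pointed_vs H') A' = lip_const X (pointed_vs H) A"
    unfolding lip_const_def by (simp add: A'dist P_def[symmetric] cong: conj_cong)
  have A': "A' \<in> Lip X (pointed_vs H')"
    using A X unfolding Lip_def Lipschitz_continuous_map_def pointed_metric_def
    by (auto simp: A'dist P_def[symmetric] A'_def dist simp del: H'(2-)) (auto simp: dist)
  have BF: "B w \<in> carrier F" if "w \<in> carrier H" for w
    using B that by (auto simp: bounded_ops_def)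
  obtain C where C: "\<forall>x\<in>carrier H. vnorm F (B x) \<le> C * vnorm H x"
    using B by (auto simp: bounded_ops_def)
  have B': "B' \<in> bounded_ops K H' F"
    using B unfolding bounded_ops_def by (auto simp: B'_def BF intro!: exI[of _ C] C[rule_format])
  have T: "T = compose P B' A'"
    by (auto simp: TBA compose_def B'_def A'_def)
  have "opnorm H' F B' \<le> opnorm H F B"
    unfolding opnorm_def
  proof (rule cSUP_mono)
    have "\<phi> \<zero>\<^bsub>H\<^esub> \<in> {u \<in> carrier H'. vnorm H' u \<le> 1}"
      by (simp add: H.vnorm_zero)
    then show "{u \<in> carrier H'. vnorm H' u \<le> 1} \<noteq> {}" by blast
    have "vnorm F (B x) \<le> \<bar>C\<bar>" if "x \<in> carrier H" "vnorm H x \<le> 1" for x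
    proof -
      have "vnorm F (B x) \<le> C * vnorm H x" using C that by blast
      also have "\<dots> \<le> \<bar>C\<bar> * vnorm H x"
        using H.vnorm_nonneg[OF that(1)] by (intro mult_right_mono) auto
      also have "\<dots> \<le> \<bar>C\<bar>"
        using that by (simp add: mult_left_le)
      finally show ?thesis .
    qed
    then show "bdd_above ((\<lambda>x. vnorm F (B x)) ` {x \<in> carrier H. vnorm H x \<le> 1})"
      by (intro bdd_aboveI2[where M = "\<bar>C\<bar>"]) auto
  next
    fix u assume "u \<in> {u \<in> carrier H'. vnorm H' u \<le> 1}"
    then obtain w where "w \<in> W" "u = \<phi> w" "vnorm H w \<le> 1" by auto
    then show "\<exists>x\<in>{x \<in> carrier H. vnorm H x \<le> 1}. vnorm F (B' u) \<le> vnorm F (B x)"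
      by (intro bexI[of _ w]) (auto simp: B'_def)
  qed
  moreover have "0 \<le> lip_const X (pointed_vs H) A"
  proof -
    obtain L where "L > 0" "\<forall>x\<in>P. \<forall>y\<in>P. vdist H (A x) (A y) \<le> L * mdist (fst X) x y"
      using A(2) unfolding Lipschitz_continuous_map_pos by (auto simp: P_def)
    then show ?thesis
      unfolding lip_const_def by (intro cInf_greatest) (auto simp: P_def intro!: exI[of _ L])
  qed
  ultimately have "opnorm H' F B' * lip_const X (pointed_vs H') A'
      \<le> opnorm H F B * lip_const X (pointed_vs H) A"
    by (simp add: lip mult_right_mono)
  moreover have "hilbert_factorization K X F T H' A' B'"
    using hH' A' B' T by (simp add: hilbert_factorization_def P_def)
  ultimately show ?thesis by blast
qed

end

theory Submission
  imports Defs
begin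

text \<open>
  Each ideal property reduces to exhibiting a factorization with a good cost, where a map costs
  \<open>b * L\<close> if it equals \<open>B \<circ> A\<close> with \<open>A\<close> Lipschitz with constant \<open>L\<close> and \<open>B\<close> linear with bound \<open>b\<close>.
  Two lemmas translate between such costs and the infimum \<open>hilbert_op_norm\<close>: any factorization
  bounds the norm by its cost (\<open>hilbert_op_norm_le\<close>), and any number above the norm exceeds the
  cost of some factorization with positive bounds (\<open>hilbert_op_norm_lessE\<close>).

  A rank one map \<open>g \<boxtimes> e\<close> factors through the scalar field, as \<open>g\<close> followed by \<open>c \<mapsto> c e\<close>. For
  a composition, \<open>B (B\<^sub>1 A\<^sub>1) A = (B B\<^sub>1) (A\<^sub>1 A)\<close>.

  The triangle inequality is the point where the Hilbert space structure enters. Given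
  \<open>S = B\<^sub>1 A\<^sub>1\<close> and \<open>T = B\<^sub>2 A\<^sub>2\<close>, write \<open>S + T\<close> as \<open>x \<mapsto> (A\<^sub>1 x, A\<^sub>2 x)\<close> followed by
  \<open>(h, k) \<mapsto> B\<^sub>1 h + B\<^sub>2 k\<close> through \<open>H\<^sub>1 \<times> H\<^sub>2\<close> with the norm \<open>sqrt (v\<^sup>2 \<parallel>h\<parallel>\<^sup>2 + w\<^sup>2 \<parallel>k\<parallel>\<^sup>2)\<close>. The first map has
  Lipschitz constant at most \<open>sqrt (v\<^sup>2 L\<^sub>1\<^sup>2 + w\<^sup>2 L\<^sub>2\<^sup>2)\<close>, and by the Cauchy-Schwarz inequality in the
  plane the second has norm at most \<open>sqrt (b\<^sub>1\<^sup>2 / v\<^sup>2 + b\<^sub>2\<^sup>2 / w\<^sup>2)\<close>. For \<open>v\<^sup>2 = b\<^sub>1 / L\<^sub>1\<close> and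
  \<open>w\<^sup>2 = b\<^sub>2 / L\<^sub>2\<close> both equal \<open>sqrt (b\<^sub>1 L\<^sub>1 + b\<^sub>2 L\<^sub>2)\<close>, so the cost of the sum is at most the sum of the
  costs. Putting the weights into the norm of the sum plays the part of the usual normalization
  of the factorizations to \<open>L\<^sub>i = b\<^sub>i\<close>.
\<close>

section \<open>Lipschitz constants and operator norms as best bounds\<close>

lemma lip_const_le:
  assumes "0 \<le> L" and "\<And>x y. x \<in> points X \<Longrightarrow> y \<in> points X \<Longrightarrow>
    mdist (fst Y) (T x) (T y) \<le> L * mdist (fst X) x y"
  shows "lip_const X Y T \<le> L"
  unfolding lip_const_def using assms by (intro cInf_lower bdd_belowI[of _ 0]) auto

text \<open>
  The set of admissible constants is closed, so the infimum is itself admissible.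
\<close>

lemma
  assumes T: "T \<in> Lip X Y"
  shows lip_const_nonneg: "0 \<le> lip_const X Y T"
    and lip_const_bound: "x \<in> points X \<Longrightarrow> y \<in> points X \<Longrightarrow>
      mdist (fst Y) (T x) (T y) \<le> lip_const X Y T * mdist (fst X) x y"
proof -
  let ?S = "{C. 0 \<le> C \<and>
    (\<forall>x\<in>points X. \<forall>y\<in>points X. mdist (fst Y) (T x) (T y) \<le> C * mdist (fst X) x y)}"
  obtain L where "L > 0"
      "\<forall>x\<in>points X. \<forall>y\<in>points X. mdist (fst Y) (T x) (T y) \<le> L * mdist (fst X) x y"
    using T unfolding Lip_def Lipschitz_continuous_map_pos by auto
  then have ne: "?S \<noteq> {}"
    by (auto intro!: exI[of _ L])
  show "0 \<le> lip_const X Y T"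
    unfolding lip_const_def by (rule cInf_greatest[OF ne]) auto
  assume xy: "x \<in> points X" "y \<in> points X"
  show "mdist (fst Y) (T x) (T y) \<le> lip_const X Y T * mdist (fst X) x y"
  proof (cases "mdist (fst X) x y = 0")
    case True
    then have "mdist (fst Y) (T x) (T y) \<le> L * 0"
      using \<open>\<forall>x\<in>points X. _\<close> xy by metis
    then show ?thesis
      using True by simp
  next
    case False
    then have pos: "mdist (fst X) x y > 0"
      by (simp add: less_le)
    have "mdist (fst Y) (T x) (T y) / mdist (fst X) x y \<le> lip_const X Y T"
      unfolding lip_const_def
      by (rule cInf_greatest[OF ne]) (use xy pos in \<open>auto simp: divide_le_eq\<close>)
    then show ?thesis
      using pos by (simp add: divide_le_eq)
  qed
qed

lemma (in normed_vs_loc) opnorm_le: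
  assumes "0 \<le> b" and "\<And>x. x \<in> carrier H \<Longrightarrow> vnorm F (B x) \<le> b * vnorm H x"
  shows "opnorm H F B \<le> b"
  unfolding opnorm_def
proof (rule cSUP_least)
  show "{x \<in> carrier H. vnorm H x \<le> 1} \<noteq> {}"
    using vnorm_zero by (auto intro!: exI[of _ "\<zero>\<^bsub>H\<^esub>"])
  fix x assume "x \<in> {x \<in> carrier H. vnorm H x \<le> 1}"
  then show "vnorm F (B x) \<le> b"
    using assms(2)[of x] mult_left_le[of "vnorm H x" b] assms(1) by auto
qed

text \<open>
  The supremum over the unit ball controls all vectors by scaling, as \<open>K\<close> contains the reals.
\<close>

lemma (in normed_vs_loc)
  assumes F: "normed_vs K F" and B: "B \<in> bounded_ops K H F"
  shows opnorm_bound: "x \<in> carrier H \<Longrightarrow> vnorm F (B x) \<le> opnorm H F B * vnorm H x"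
    and opnorm_nonneg: "0 \<le> opnorm H F B"
proof -
  interpret F: normed_vs_loc K F
    by (rule normed_vs_locI[OF K F])
  obtain C where C: "\<And>x. x \<in> carrier H \<Longrightarrow> vnorm F (B x) \<le> C * vnorm H x"
    using B unfolding bounded_ops_def by blast
  have BF: "B x \<in> carrier F" if "x \<in> carrier H" for x
    using B that by (auto simp: bounded_ops_def)
  have "vnorm F (B x) \<le> \<bar>C\<bar>" if "x \<in> carrier H" "vnorm H x \<le> 1" for x
  proof -
    have "C * vnorm H x \<le> \<bar>C\<bar> * 1"
      using that vnorm_nonneg[of x] by (intro mult_mono) auto
    then show ?thesis
      using C[OF that(1)] by simp
  qed
  then have bdd: "bdd_above ((\<lambda>x. vnorm F (B x)) ` {x \<in> carrier H. vnorm H x \<le> 1})"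
    by (intro bdd_aboveI2[where M = "\<bar>C\<bar>"]) auto
  have unit: "vnorm F (B x) \<le> opnorm H F B" if "x \<in> carrier H" "vnorm H x \<le> 1" for x
    unfolding opnorm_def using that by (intro cSUP_upper[OF _ bdd]) auto
  show "0 \<le> opnorm H F B"
    using unit[of "\<zero>\<^bsub>H\<^esub>"] F.vnorm_nonneg[OF BF, of "\<zero>\<^bsub>H\<^esub>"] by (simp add: vnorm_zero)
  assume x: "x \<in> carrier H"
  show "vnorm F (B x) \<le> opnorm H F B * vnorm H x"
  proof (cases "vnorm H x = 0")
    case True
    then show ?thesis
      using C[OF x] by simp
  next
    case False
    then have pos: "vnorm H x > 0"
      using vnorm_nonneg[OF x] by simp
    let ?c = "complex_of_real (1 / vnorm H x)"
    have c: "?c \<in> K"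
      by (rule K_closed)
    have B_c: "B (?c \<odot>\<^bsub>H\<^esub> x) = ?c \<odot>\<^bsub>F\<^esub> B x"
      using B x c unfolding bounded_ops_def by blast
    have "vnorm F (B (?c \<odot>\<^bsub>H\<^esub> x)) = vnorm F (B x) / vnorm H x"
      unfolding B_c F.vnorm_smult[OF c BF[OF x]] using pos by (simp add: norm_divide)
    moreover have "vnorm H (?c \<odot>\<^bsub>H\<^esub> x) = 1"
      unfolding vnorm_smult[OF c x] using pos by (simp add: norm_divide)
    ultimately show ?thesis
      using unit[of "?c \<odot>\<^bsub>H\<^esub> x"] smult_in[OF c x] pos by (simp add: divide_le_eq)
  qed
qed


section \<open>Factorizations with prescribed bounds\<close>

lemma (in normed_vs_loc) vdist_linear:
  assumes F: "normed_vs K F"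
    and BF: "\<And>u. u \<in> carrier H \<Longrightarrow> B u \<in> carrier F"
    and add: "\<And>u v. u \<in> carrier H \<Longrightarrow> v \<in> carrier H \<Longrightarrow> B (u \<oplus>\<^bsub>H\<^esub> v) = B u \<oplus>\<^bsub>F\<^esub> B v"
    and smult: "\<And>c u. c \<in> K \<Longrightarrow> u \<in> carrier H \<Longrightarrow> B (c \<odot>\<^bsub>H\<^esub> u) = c \<odot>\<^bsub>F\<^esub> B u"
    and uv: "u \<in> carrier H" "v \<in> carrier H"
  shows "vdist F (B u) (B v) = vnorm F (B (u \<ominus>\<^bsub>H\<^esub> v))"
proof -
  interpret F: normed_vs_loc K F
    by (rule normed_vs_locI[OF K F])
  show ?thesis
    using uv BF by (simp add: vdist_def diff_eq F.diff_eq add smult)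
qed

text \<open>
  A factorization with explicit, possibly non-optimal bounds. The maps \<open>A\<close> and \<open>B\<close> may take any
  values off their carriers, so that factorizations can be written down as plain terms; this and
  the inequalities replace extensionality, the infimum \<open>lip_const\<close> and the supremum \<open>opnorm\<close>.
\<close>

locale bounded_factorization =
  fixes K and X :: "'a pointed" and F :: "'b normed_space" and T
    and H :: "'h normed_space" and A B and b L :: real
  assumes hilbert: "hilbert_vs K H"
    and b_nonneg: "0 \<le> b" and L_nonneg: "0 \<le> L"
    and A_in: "x \<in> points X \<Longrightarrow> A x \<in> carrier H"
    and A_base: "A (snd X) = \<zero>\<^bsub>H\<^esub>"
    and A_lipschitz: "x \<in> points X \<Longrightarrow> y \<in> points X \<Longrightarrow>
      vdist H (A x) (A y) \<le> L * mdist (fst X) x y"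
    and B_in: "u \<in> carrier H \<Longrightarrow> B u \<in> carrier F"
    and B_add: "u \<in> carrier H \<Longrightarrow> v \<in> carrier H \<Longrightarrow> B (u \<oplus>\<^bsub>H\<^esub> v) = B u \<oplus>\<^bsub>F\<^esub> B v"
    and B_smult: "c \<in> K \<Longrightarrow> u \<in> carrier H \<Longrightarrow> B (c \<odot>\<^bsub>H\<^esub> u) = c \<odot>\<^bsub>F\<^esub> B u"
    and B_bounded: "u \<in> carrier H \<Longrightarrow> vnorm F (B u) \<le> b * vnorm H u"
    and T_eq: "T = (\<lambda>x\<in>points X. B (A x))"

text \<open>
  The space \<open>H\<close> has vectors of an arbitrary type here, which makes products and the scalar field
  available as intermediate spaces; \<open>hilbert_factorization_any_type\<close> moves the factorization to
  the type over which the infimum is formed.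
\<close>

lemma (in bounded_factorization) hilbert_op_norm_le:
  assumes K: "K = \<real> \<or> K = UNIV" and X: "pointed_metric X" and F: "banach_vs K F"
  shows "T \<in> hilbert_ops K X F" "hilbert_op_norm K X F T \<le> b * L"
proof -
  have nH: "normed_vs K H" and nF: "normed_vs K F"
    using hilbert F by (auto simp: hilbert_vs_def banach_vs_def)
  interpret H: normed_vs_loc K H
    by (rule normed_vs_locI[OF K nH])
  interpret F: normed_vs_loc K F
    by (rule normed_vs_locI[OF K nF])
  have X0: "snd X \<in> points X"
    using X by (simp add: pointed_metric_def)
  define A' where "A' = restrict A (points X)"
  define B' where "B' = restrict B (carrier H)"
  have A': "A' \<in> Lip X (pointed_vs H)"
    unfolding Lip_def Lipschitz_continuous_map_def A'_def
    using A_in A_base A_lipschitz X0 by auto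
  have B': "B' \<in> bounded_ops K H F"
    unfolding bounded_ops_def B'_def using B_in B_add B_smult B_bounded by (auto intro!: exI[of _ b])
  have fac: "hilbert_factorization K X F T H A' B'"
    unfolding hilbert_factorization_def
    using hilbert A' B' by (auto simp: T_eq A'_def B'_def compose_def A_in)
  have "T \<in> Lip X (pointed_vs F)"
  proof -
    have B0: "B \<zero>\<^bsub>H\<^esub> = \<zero>\<^bsub>F\<^esub>"
      using B_bounded[of "\<zero>\<^bsub>H\<^esub>"] F.vnorm_zeroD[OF B_in, of "\<zero>\<^bsub>H\<^esub>"] F.vnorm_nonneg[OF B_in, of "\<zero>\<^bsub>H\<^esub>"]
      by (simp add: H.vnorm_zero)
    have "vdist F (B (A x)) (B (A y)) \<le> (b * L) * mdist (fst X) x y"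
      if "x \<in> points X" "y \<in> points X" for x y
    proof -
      have "vdist F (B (A x)) (B (A y)) = vnorm F (B (A x \<ominus>\<^bsub>H\<^esub> A y))"
        using that A_in by (intro H.vdist_linear[OF nF B_in B_add B_smult]) auto
      also have "\<dots> \<le> b * vdist H (A x) (A y)"
        using B_bounded[of "A x \<ominus>\<^bsub>H\<^esub> A y"] A_in that by (simp add: vdist_def)
      also have "\<dots> \<le> b * (L * mdist (fst X) x y)"
        using A_lipschitz that b_nonneg L_nonneg by (intro mult_left_mono) auto
      finally show ?thesis
        by (simp add: mult.assoc)
    qed
    then show ?thesis
      unfolding Lip_def Lipschitz_continuous_map_def T_eq
      using A_in B_in A_base X0 B0 by (auto intro!: exI[of _ "b * L"])
  qed
  moreover obtain H1 :: "('a \<Rightarrow> complex) normed_space" and A1 B1 where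
      fac1: "hilbert_factorization K X F T H1 A1 B1" and
      le: "opnorm H1 F B1 * lip_const X (pointed_vs H1) A1
        \<le> opnorm H F B' * lip_const X (pointed_vs H) A'"
    using hilbert_factorization_any_type[OF K X F fac] by blast
  moreover have "hilbert_op_norm K X F T \<le> b * L"
  proof -
    let ?S = "{opnorm H F B * lip_const X (pointed_vs H) A |
      (H :: ('a \<Rightarrow> complex) normed_space) A B. hilbert_factorization K X F T H A B}"
    \<comment> \<open>On an unbounded set of reals \<open>Inf\<close> would be an unspecified number.\<close>
    have "bdd_below ?S"
    proof (rule bdd_belowI[of _ 0])
      fix r assume "r \<in> ?S"
      then obtain G :: "('a \<Rightarrow> complex) normed_space" and A2 B2 where
          r: "r = opnorm G F B2 * lip_const X (pointed_vs G) A2" and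
          fac2: "hilbert_factorization K X F T G A2 B2"
        by blast
      interpret G: normed_vs_loc K G
        using fac2 by (intro normed_vs_locI[OF K])
          (auto simp: hilbert_factorization_def hilbert_vs_def banach_vs_def)
      show "0 \<le> r"
        unfolding r using fac2 G.opnorm_nonneg[OF nF, of B2] lip_const_nonneg[of A2 X "pointed_vs G"]
        by (auto simp: hilbert_factorization_def)
    qed
    moreover have "opnorm H1 F B1 * lip_const X (pointed_vs H1) A1 \<in> ?S"
      using fac1 by blast
    ultimately have "hilbert_op_norm K X F T \<le> opnorm H1 F B1 * lip_const X (pointed_vs H1) A1"
      unfolding hilbert_op_norm_def by (rule cInf_lower[rotated])
    also note le
    also have "opnorm H F B' * lip_const X (pointed_vs H) A' \<le> b * L"
    proof (rule mult_mono)
      show "opnorm H F B' \<le> b"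
        using b_nonneg L_nonneg B_bounded by (intro H.opnorm_le) (auto simp: B'_def)
      show "lip_const X (pointed_vs H) A' \<le> L"
        using b_nonneg L_nonneg A_lipschitz by (intro lip_const_le) (auto simp: A'_def)
    qed (use b_nonneg L_nonneg lip_const_nonneg[OF A'] in auto)
    finally show ?thesis .
  qed
  ultimately show "T \<in> hilbert_ops K X F" "hilbert_op_norm K X F T \<le> b * L"
    unfolding hilbert_ops_def by blast+
qed

text \<open>
  Optimal bounds may vanish, whereas the weights \<open>b / L\<close> used for sums need positive ones; a strict
  inequality for the product leaves room to enlarge both factors.
\<close>

lemma strict_product_bounds:
  fixes p q c :: real
  assumes "0 \<le> p" "0 \<le> q" "p * q < c"
  obtains b L where "p \<le> b" "q \<le> L" "0 < b" "0 < L" "b * L < c"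
proof -
  \<comment> \<open>Since \<open>e \<le> 1\<close>, enlarging both factors by \<open>e\<close> adds less than \<open>e * (p + q + 2)\<close> to the product.\<close>
  define e where "e = min 1 ((c - p * q) / (p + q + 2))"
  have pos: "0 < p + q + 2"
    using assms by simp
  then have e: "0 < e" "e \<le> 1"
    using assms by (auto simp: e_def)
  have "e * (p + q + 2) \<le> c - p * q"
    unfolding pos_le_divide_eq[OF pos, symmetric] e_def by simp
  have "e * (p + q + e) < e * (p + q + 2)"
    using e by (intro mult_strict_left_mono) auto
  then have "(p + e) * (q + e) < c"
    using \<open>e * (p + q + 2) \<le> c - p * q\<close> by (simp add: algebra_simps)
  then show thesis
    using assms e by (intro that[of "p + e" "q + e"]) auto
qed

lemma hilbert_op_norm_lessE:
  fixes X :: "'a pointed" and F :: "'b normed_space"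
  assumes K: "K = \<real> \<or> K = UNIV" and F: "banach_vs K F"
    and T: "T \<in> hilbert_ops K X F" and c: "hilbert_op_norm K X F T < c"
  obtains H :: "('a \<Rightarrow> complex) normed_space" and A B b L where
    "bounded_factorization K X F T H A B b L" "0 < b" "0 < L" "b * L < c"
proof -
  have nF: "normed_vs K F"
    using F by (simp add: banach_vs_def)
  let ?S = "{opnorm H F B * lip_const X (pointed_vs H) A |
    (H :: ('a \<Rightarrow> complex) normed_space) A B. hilbert_factorization K X F T H A B}"
  have "?S \<noteq> {}"
    using T by (auto simp: hilbert_ops_def)
  then obtain H :: "('a \<Rightarrow> complex) normed_space" and A B where
      fac: "hilbert_factorization K X F T H A B" and
      less: "opnorm H F B * lip_const X (pointed_vs H) A < c"
    using cInf_lessD[of ?S c] c unfolding hilbert_op_norm_def by blast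
  have H: "hilbert_vs K H" and A: "A \<in> Lip X (pointed_vs H)" and B: "B \<in> bounded_ops K H F"
    and TBA: "T = compose (points X) B A"
    using fac by (auto simp: hilbert_factorization_def)
  interpret H: normed_vs_loc K H
    using H by (intro normed_vs_locI[OF K]) (auto simp: hilbert_vs_def banach_vs_def)
  obtain b L where bL: "opnorm H F B \<le> b" "lip_const X (pointed_vs H) A \<le> L"
      "0 < b" "0 < L" "b * L < c"
    using strict_product_bounds[OF H.opnorm_nonneg[OF nF B] lip_const_nonneg[OF A] less] .
  show thesis
  proof (rule that[OF _ bL(3-5)], unfold_locales)
    show "hilbert_vs K H" "0 \<le> b" "0 \<le> L"
      using H bL by auto
    show "A x \<in> carrier H" if "x \<in> points X" for x
      using A that by (auto simp: Lip_def)
    show "A (snd X) = \<zero>\<^bsub>H\<^esub>"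
      using A by (auto simp: Lip_def)
    show "vdist H (A x) (A y) \<le> L * mdist (fst X) x y" if "x \<in> points X" "y \<in> points X" for x y
      using lip_const_bound[OF A that] mult_right_mono[OF bL(2), of "mdist (fst X) x y"] by simp
    show "vnorm F (B u) \<le> b * vnorm H u" if "u \<in> carrier H" for u
      using H.opnorm_bound[OF nF B that] mult_right_mono[OF bL(1) H.vnorm_nonneg[OF that]] by simp
  qed (use B TBA in \<open>auto simp: bounded_ops_def compose_def\<close>)
qed


section \<open>The scalar field as a Hilbert space\<close>

definition scalar_space :: "complex set \<Rightarrow> complex normed_space" where
  "scalar_space K = \<lparr>carrier = K, mult = (*), one = 1, zero = 0, add = (+), smult = (*),
     vnorm = cmod\<rparr>"

lemma scalar_space_simps [simp]:
  "carrier (scalar_space K) = K" "\<zero>\<^bsub>scalar_space K\<^esub> = 0"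
  "x \<oplus>\<^bsub>scalar_space K\<^esub> y = x + y" "c \<odot>\<^bsub>scalar_space K\<^esub> x = c * x"
  "vnorm (scalar_space K) = cmod"
  by (simp_all add: scalar_space_def)

lemma cring_scalar_ring:
  assumes K: "K = \<real> \<or> K = UNIV"
  shows "cring (scalar_ring K)"
proof (rule cringI)
  show "abelian_group (scalar_ring K)"
  proof (rule abelian_groupI)
    fix x assume "x \<in> carrier (scalar_ring K)"
    then show "\<exists>y\<in>carrier (scalar_ring K). y \<oplus>\<^bsub>scalar_ring K\<^esub> x = \<zero>\<^bsub>scalar_ring K\<^esub>"
      using K by (intro bexI[of _ "- x"]) auto
  qed (use K in auto)
  show "Group.comm_monoid (scalar_ring K)"
    by (rule comm_monoidI) (use K in auto)
qed (auto simp: distrib_right)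

lemma normed_vs_scalar_space:
  assumes K: "K = \<real> \<or> K = UNIV"
  shows "normed_vs K (scalar_space K)"
proof -
  have "abelian_group (scalar_space K)"
  proof (rule abelian_groupI)
    fix x assume "x \<in> carrier (scalar_space K)"
    then show "\<exists>y\<in>carrier (scalar_space K). y \<oplus>\<^bsub>scalar_space K\<^esub> x = \<zero>\<^bsub>scalar_space K\<^esub>"
      using K by (intro bexI[of _ "- x"]) auto
  qed (use K in auto)
  then have "Module.module (scalar_ring K) (scalar_space K)"
    by (rule Module.moduleI[OF cring_scalar_ring[OF K]]) (use K in \<open>auto simp: algebra_simps\<close>)
  then show ?thesis
    unfolding normed_vs_def by (auto simp: norm_mult norm_triangle_ineq)
qed

lemma vdist_scalar_space:
  assumes K: "K = \<real> \<or> K = UNIV" and "x \<in> K" "y \<in> K"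
  shows "vdist (scalar_space K) x y = dist x y"
proof -
  interpret S: normed_vs_loc K "scalar_space K"
    by (rule normed_vs_locI[OF K normed_vs_scalar_space[OF K]])
  show ?thesis
    using assms(2-) S.diff_eq[of x y] by (simp add: vdist_def dist_norm)
qed

lemma hilbert_vs_scalar_space:
  assumes K: "K = \<real> \<or> K = UNIV"
  shows "hilbert_vs K (scalar_space K)"
proof -
  interpret S: normed_vs_loc K "scalar_space K"
    by (rule normed_vs_locI[OF K normed_vs_scalar_space[OF K]])
  interpret M: Metric_space K "vdist (scalar_space K)"
    using S.metric_space by simp
  have "closed K"
    using K closed_complex_Reals by auto
  have "M.mcomplete"
    unfolding M.mcomplete_def
  proof (intro allI impI)
    fix s assume s: "M.MCauchy s"
    then have sK: "s n \<in> K" for n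
      by (auto simp: M.MCauchy_def)
    have "Cauchy s"
      using s unfolding M.MCauchy_def Cauchy_def by (simp add: vdist_scalar_space[OF K] sK)
    then obtain l where l: "s \<longlonglongrightarrow> l"
      using Cauchy_convergent convergent_def by blast
    then have "l \<in> K"
      using \<open>closed K\<close> sK closed_sequentially by blast
    then have "limitin M.mtopology s l sequentially"
      using l by (simp add: M.limit_metric_sequentially LIMSEQ_def vdist_scalar_space[OF K] sK)
    then show "\<exists>l. limitin M.mtopology s l sequentially" by blast
  qed
  then have "banach_vs K (scalar_space K)"
    by (simp add: banach_vs_def normed_vs_scalar_space[OF K])
  moreover have "inner_product_on K (scalar_space K) (\<lambda>x y. x * cnj y)"
    unfolding inner_product_on_def using K
    by (auto simp: algebra_simps Reals_cnj_iff)
  ultimately show ?thesis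
    unfolding hilbert_vs_def by (auto simp: cmod_def power2_eq_square)
qed


section \<open>Weighted Hilbert sums\<close>

text \<open>
  The parameters \<open>v\<close> and \<open>w\<close> scale the norms of the two summands, so they enter the inner product
  as \<open>v\<^sup>2\<close> and \<open>w\<^sup>2\<close>. The norm is that of a vector in the real plane, whose triangle and
  Cauchy-Schwarz inequalities then carry over.
\<close>

definition hilbert_sum ::
    "real \<Rightarrow> real \<Rightarrow> 'h normed_space \<Rightarrow> 'k normed_space \<Rightarrow> ('h \<times> 'k) normed_space" where
  "hilbert_sum v w H G =
     \<lparr>carrier = carrier H \<times> carrier G, mult = (\<lambda>p q. p), one = (\<zero>\<^bsub>H\<^esub>, \<zero>\<^bsub>G\<^esub>),
      zero = (\<zero>\<^bsub>H\<^esub>, \<zero>\<^bsub>G\<^esub>),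
      add = (\<lambda>p q. (fst p \<oplus>\<^bsub>H\<^esub> fst q, snd p \<oplus>\<^bsub>G\<^esub> snd q)),
      smult = (\<lambda>c p. (c \<odot>\<^bsub>H\<^esub> fst p, c \<odot>\<^bsub>G\<^esub> snd p)),
      vnorm = (\<lambda>p. norm (v * vnorm H (fst p), w * vnorm G (snd p)))\<rparr>"

lemma hilbert_sum_simps [simp]:
  "carrier (hilbert_sum v w H G) = carrier H \<times> carrier G"
  "\<zero>\<^bsub>hilbert_sum v w H G\<^esub> = (\<zero>\<^bsub>H\<^esub>, \<zero>\<^bsub>G\<^esub>)"
  "p \<oplus>\<^bsub>hilbert_sum v w H G\<^esub> q = (fst p \<oplus>\<^bsub>H\<^esub> fst q, snd p \<oplus>\<^bsub>G\<^esub> snd q)"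
  "c \<odot>\<^bsub>hilbert_sum v w H G\<^esub> p = (c \<odot>\<^bsub>H\<^esub> fst p, c \<odot>\<^bsub>G\<^esub> snd p)"
  "vnorm (hilbert_sum v w H G) p = norm (v * vnorm H (fst p), w * vnorm G (snd p))"
  by (simp_all add: hilbert_sum_def)

lemma norm_Pair_mono:
  fixes a b c d :: real
  assumes "0 \<le> a" "a \<le> c" "0 \<le> b" "b \<le> d"
  shows "norm (a, b) \<le> norm (c, d)"
  using assms by (auto simp: norm_Pair intro!: add_mono power_mono)

lemma normed_vs_hilbert_sum:
  assumes K: "K = \<real> \<or> K = UNIV" and H: "normed_vs K H" and G: "normed_vs K G"
    and vw: "0 < v" "0 < w"
  shows "normed_vs K (hilbert_sum v w H G)"
proof -
  interpret H: normed_vs_loc K H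
    by (rule normed_vs_locI[OF K H])
  interpret G: normed_vs_loc K G
    by (rule normed_vs_locI[OF K G])
  let ?S = "hilbert_sum v w H G"
  have ag: "abelian_group ?S"
  proof (rule abelian_groupI)
    fix p assume "p \<in> carrier ?S"
    then show "\<exists>q\<in>carrier ?S. q \<oplus>\<^bsub>?S\<^esub> p = \<zero>\<^bsub>?S\<^esub>"
      by (intro bexI[of _ "(\<ominus>\<^bsub>H\<^esub> fst p, \<ominus>\<^bsub>G\<^esub> snd p)"]) (auto simp: H.M.l_neg G.M.l_neg)
  qed (auto simp: H.M.a_ac G.M.a_ac)
  have "Module.module (scalar_ring K) ?S"
    by (rule Module.moduleI[OF H.R.is_cring ag])
      (use H.smult_l_distr H.smult_r_distr H.smult_assoc1 H.smult_one
        G.smult_l_distr G.smult_r_distr G.smult_assoc1 G.smult_one in auto)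
  moreover have "vnorm ?S (c \<odot>\<^bsub>?S\<^esub> p) = cmod c * vnorm ?S p" if "c \<in> K" "p \<in> carrier ?S" for c p
  proof -
    have "vnorm ?S (c \<odot>\<^bsub>?S\<^esub> p) = norm (cmod c *\<^sub>R (v * vnorm H (fst p), w * vnorm G (snd p)))"
      using that by (auto simp: H.vnorm_smult G.vnorm_smult algebra_simps)
    then show ?thesis
      unfolding norm_scaleR by simp
  qed
  moreover have "vnorm ?S (p \<oplus>\<^bsub>?S\<^esub> q) \<le> vnorm ?S p + vnorm ?S q"
    if p: "p \<in> carrier ?S" and q: "q \<in> carrier ?S" for p q
  proof -
    have "vnorm ?S (p \<oplus>\<^bsub>?S\<^esub> q) \<le> norm (v * (vnorm H (fst p) + vnorm H (fst q)),
        w * (vnorm G (snd p) + vnorm G (snd q)))"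
      unfolding hilbert_sum_simps using p q vw
      by (intro norm_Pair_mono)
        (auto intro!: mult_left_mono H.vnorm_triangle G.vnorm_triangle simp: H.vnorm_nonneg G.vnorm_nonneg)
    also have "\<dots> = norm ((v * vnorm H (fst p), w * vnorm G (snd p)) +
        (v * vnorm H (fst q), w * vnorm G (snd q)))"
      by (simp add: distrib_left)
    also have "\<dots> \<le> vnorm ?S p + vnorm ?S q"
      unfolding hilbert_sum_simps by (rule norm_triangle_ineq)
    finally show ?thesis .
  qed
  moreover have "p = \<zero>\<^bsub>?S\<^esub>" if "p \<in> carrier ?S" "vnorm ?S p = 0" for p
    using that vw by (auto simp: zero_prod_def H.vnorm_zeroD G.vnorm_zeroD)
  ultimately show ?thesis
    unfolding normed_vs_def by auto
qed

lemma vdist_hilbert_sum: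
  assumes K: "K = \<real> \<or> K = UNIV" and H: "normed_vs K H" and G: "normed_vs K G"
    and vw: "0 < v" "0 < w" and xy: "x \<in> carrier H" "x' \<in> carrier H" "y \<in> carrier G" "y' \<in> carrier G"
  shows "vdist (hilbert_sum v w H G) (x, y) (x', y') = norm (v * vdist H x x', w * vdist G y y')"
proof -
  interpret H: normed_vs_loc K H
    by (rule normed_vs_locI[OF K H])
  interpret G: normed_vs_loc K G
    by (rule normed_vs_locI[OF K G])
  interpret S: normed_vs_loc K "hilbert_sum v w H G"
    by (rule normed_vs_locI[OF K normed_vs_hilbert_sum[OF K H G vw]])
  show ?thesis
    using xy by (simp add: vdist_def S.diff_eq H.diff_eq G.diff_eq)
qed

lemma hilbert_vs_hilbert_sum:
  assumes K: "K = \<real> \<or> K = UNIV" and H: "hilbert_vs K H" and G: "hilbert_vs K G"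
    and vw: "0 < v" "0 < w"
  shows "hilbert_vs K (hilbert_sum v w H G)"
proof -
  let ?S = "hilbert_sum v w H G"
  have nH: "normed_vs K H" and nG: "normed_vs K G"
    and cH: "Metric_space.mcomplete (carrier H) (vdist H)"
    and cG: "Metric_space.mcomplete (carrier G) (vdist G)"
    using H G by (auto simp: hilbert_vs_def banach_vs_def)
  obtain ipH where ipH: "inner_product_on K H ipH"
      "\<And>x. x \<in> carrier H \<Longrightarrow> vnorm H x = sqrt (Re (ipH x x))"
    using H by (auto simp: hilbert_vs_def)
  obtain ipG where ipG: "inner_product_on K G ipG"
      "\<And>x. x \<in> carrier G \<Longrightarrow> vnorm G x = sqrt (Re (ipG x x))"
    using G by (auto simp: hilbert_vs_def)
  interpret H: hilbert_ip K H ipH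
    unfolding hilbert_ip_def hilbert_ip_axioms_def using ipH normed_vs_locI[OF K nH] by auto
  interpret G: hilbert_ip K G ipG
    unfolding hilbert_ip_def hilbert_ip_axioms_def using ipG normed_vs_locI[OF K nG] by auto
  have nS: "normed_vs K ?S"
    by (rule normed_vs_hilbert_sum[OF K nH nG vw])
  interpret S: normed_vs_loc K ?S
    by (rule normed_vs_locI[OF K nS])
  interpret MH: Metric_space "carrier H" "vdist H"
    by (rule H.metric_space)
  interpret MG: Metric_space "carrier G" "vdist G"
    by (rule G.metric_space)
  interpret MS: Metric_space "carrier ?S" "vdist ?S"
    by (rule S.metric_space)
  note dist = vdist_hilbert_sum[OF K nH nG vw]
  have "MS.mcomplete"
    unfolding MS.mcomplete_def
  proof (intro allI impI)
    fix s assume s: "MS.MCauchy s"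
    define x y where "x n = fst (s n)" and "y n = snd (s n)" for n
    have sxy: "s n = (x n, y n)" for n
      by (simp add: x_def y_def)
    have xH [simp]: "x n \<in> carrier H" and yG [simp]: "y n \<in> carrier G" for n
      using s unfolding MS.MCauchy_def by (auto simp: sxy image_subset_iff)
    have le: "v * vdist H (x m) (x n) \<le> vdist ?S (s m) (s n)"
        "w * vdist G (y m) (y n) \<le> vdist ?S (s m) (s n)" for m n
      using norm_fst_le[of "v * vdist H (x m) (x n)" "w * vdist G (y m) (y n)"]
        norm_snd_le[of "w * vdist G (y m) (y n)" "v * vdist H (x m) (x n)"]
      by (simp_all add: sxy dist)
    have "MH.MCauchy x"
      unfolding MH.MCauchy_def
    proof (intro conjI allI impI)
      fix e :: real assume "e > 0"
      then obtain N where "\<And>m n. N \<le> m \<Longrightarrow> N \<le> n \<Longrightarrow> vdist ?S (s m) (s n) < v * e"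
        using s vw unfolding MS.MCauchy_def by (meson mult_pos_pos)
      then show "\<exists>N. \<forall>n n'. N \<le> n \<longrightarrow> N \<le> n' \<longrightarrow> vdist H (x n) (x n') < e"
        using le(1) vw by (meson le_less_trans mult_less_cancel_left_pos)
    qed auto
    then obtain a where a: "limitin MH.mtopology x a sequentially"
      using cH by (auto simp: MH.mcomplete_def)
    have "MG.MCauchy y"
      unfolding MG.MCauchy_def
    proof (intro conjI allI impI)
      fix e :: real assume "e > 0"
      then obtain N where "\<And>m n. N \<le> m \<Longrightarrow> N \<le> n \<Longrightarrow> vdist ?S (s m) (s n) < w * e"
        using s vw unfolding MS.MCauchy_def by (meson mult_pos_pos)
      then show "\<exists>N. \<forall>n n'. N \<le> n \<longrightarrow> N \<le> n' \<longrightarrow> vdist G (y n) (y n') < e"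
        using le(2) vw by (meson le_less_trans mult_less_cancel_left_pos)
    qed auto
    then obtain b where b: "limitin MG.mtopology y b sequentially"
      using cG by (auto simp: MG.mcomplete_def)
    have aH: "a \<in> carrier H" and bG: "b \<in> carrier G"
      using a b MH.limitin_mspace MG.limitin_mspace by blast+
    have "limitin MS.mtopology s (a, b) sequentially"
      unfolding MS.limitin_metric_dist_null
    proof (intro conjI)
      have "(\<lambda>n. norm (v * vdist H (x n) a, w * vdist G (y n) b)) \<longlonglongrightarrow> norm (v * 0, w * (0::real))"
        using a b unfolding MH.limitin_metric_dist_null MG.limitin_metric_dist_null
        by (intro tendsto_intros) auto
      then show "(\<lambda>n. vdist ?S (s n) (a, b)) \<longlonglongrightarrow> 0"
        using aH bG by (simp add: sxy dist)
    qed (use aH bG sxy in auto)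
    then show "\<exists>l. limitin MS.mtopology s l sequentially" by blast
  qed
  then have bS: "banach_vs K ?S"
    using nS by (simp add: banach_vs_def)
  define ip where "ip p q = of_real (v\<^sup>2) * ipH (fst p) (fst q) + of_real (w\<^sup>2) * ipG (snd p) (snd q)"
    for p q
  have ip_self: "ip p p = of_real ((v * vnorm H (fst p))\<^sup>2 + (w * vnorm G (snd p))\<^sup>2)"
    if "p \<in> carrier ?S" for p
  proof -
    have "ipH (fst p) (fst p) = of_real ((vnorm H (fst p))\<^sup>2)"
      "ipG (snd p) (snd p) = of_real ((vnorm G (snd p))\<^sup>2)"
      using that H.ip_self[of "fst p"] G.ip_self[of "snd p"] H.ip_nonneg[of "fst p"]
        G.ip_nonneg[of "snd p"] H.vnorm_ip[of "fst p"] G.vnorm_ip[of "snd p"]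
      by (auto simp del: of_real_power)
    then show ?thesis
      by (simp add: ip_def power_mult_distrib)
  qed
  have norm: "vnorm ?S p = sqrt (Re (ip p p))" if "p \<in> carrier ?S" for p
    unfolding ip_self[OF that] by (simp add: norm_Pair)
  have "inner_product_on K ?S ip"
    unfolding inner_product_on_def
  proof (intro conjI ballI impI)
    fix p q assume pq: "p \<in> carrier ?S" "q \<in> carrier ?S"
    then show "ip p q \<in> K"
      unfolding ip_def by (intro H.K_closed) (auto simp: H.ip_in G.ip_in)
    show "ip q p = cnj (ip p q)"
      using pq H.ip_sym[of "fst p" "fst q"] G.ip_sym[of "snd p" "snd q"] by (auto simp: ip_def)
  next
    fix p assume p: "p \<in> carrier ?S"
    then show "0 \<le> Re (ip p p)"
      by (simp add: ip_self del: of_real_power)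
    assume "ip p p = 0"
    then have "vnorm ?S p = 0"
      using norm[OF p] by simp
    then show "p = \<zero>\<^bsub>?S\<^esub>"
      by (rule S.vnorm_zeroD[OF p])
  qed (auto simp: ip_def H.ip_add G.ip_add H.ip_smult G.ip_smult algebra_simps)
  then show ?thesis
    unfolding hilbert_vs_def using bS norm by blast
qed


section \<open>The ideal properties\<close>

lemma hilbert_op_rank_one:
  assumes K: "K = \<real> \<or> K = UNIV" and X: "pointed_metric X" and F: "banach_vs K F"
    and g: "g \<in> lip_dual K X" and e: "e \<in> carrier F"
  shows "rank_one X F g e \<in> hilbert_ops K X F"
    and "hilbert_op_norm K X F (rank_one X F g e) \<le> lip_const X (pointed_scalars K) g * vnorm F e"
proof -
  interpret F: normed_vs_loc K F
    using F by (intro normed_vs_locI[OF K]) (simp add: banach_vs_def)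
  have g': "g \<in> Lip X (pointed_scalars K)"
    using g by (simp add: lip_dual_def)
  have gK: "g x \<in> K" if "x \<in> points X" for x
    using g' that by (auto simp: Lip_def pointed_scalars_def)
  interpret G: bounded_factorization K X F "rank_one X F g e" "scalar_space K" g
    "\<lambda>c. c \<odot>\<^bsub>F\<^esub> e" "vnorm F e" "lip_const X (pointed_scalars K) g"
  proof unfold_locales
    show "hilbert_vs K (scalar_space K)"
      by (rule hilbert_vs_scalar_space[OF K])
    show "0 \<le> vnorm F e"
      by (rule F.vnorm_nonneg[OF e])
    show "0 \<le> lip_const X (pointed_scalars K) g"
      by (rule lip_const_nonneg[OF g'])
    show "vdist (scalar_space K) (g x) (g y) \<le> lip_const X (pointed_scalars K) g * mdist (fst X) x y"
      if "x \<in> points X" "y \<in> points X" for x y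
      using lip_const_bound[OF g' that] that by (simp add: vdist_scalar_space[OF K] gK pointed_scalars_def)
    show "g (snd X) = \<zero>\<^bsub>scalar_space K\<^esub>"
      using g' by (simp add: Lip_def pointed_scalars_def)
  qed (use gK e F.smult_l_distr F.smult_assoc1 in
      \<open>auto simp: rank_one_def F.vnorm_smult mult.commute\<close>)
  show "rank_one X F g e \<in> hilbert_ops K X F"
      "hilbert_op_norm K X F (rank_one X F g e) \<le> lip_const X (pointed_scalars K) g * vnorm F e"
    using G.hilbert_op_norm_le[OF K X F] by (auto simp: mult.commute)
qed

text \<open>
  In the weighted sum, the left-hand sides are the Lipschitz bound of \<open>(A\<^sub>1, A\<^sub>2)\<close> and the operator
  bound of \<open>B\<^sub>1 + B\<^sub>2\<close>; the weights are chosen to make them equal.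
\<close>

lemma balanced_weights:
  fixes b1 b2 L1 L2 :: real
  assumes pos: "0 < b1" "0 < b2" "0 < L1" "0 < L2"
  defines "v \<equiv> sqrt (b1 / L1)" and "w \<equiv> sqrt (b2 / L2)"
  shows "norm (v * L1, w * L2) = sqrt (b1 * L1 + b2 * L2)"
    and "norm (b1 / v, b2 / w) = sqrt (b1 * L1 + b2 * L2)"
proof -
  have "(v * L1)\<^sup>2 = b1 * L1" "(w * L2)\<^sup>2 = b2 * L2"
    unfolding v_def w_def power_mult_distrib using pos by (simp_all add: field_simps power2_eq_square)
  then show "norm (v * L1, w * L2) = sqrt (b1 * L1 + b2 * L2)"
    by (simp add: norm_Pair)
  have "(b1 / v)\<^sup>2 = b1 * L1" "(b2 / w)\<^sup>2 = b2 * L2"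
    unfolding v_def w_def power_divide using pos by (simp_all add: field_simps power2_eq_square)
  then show "norm (b1 / v, b2 / w) = sqrt (b1 * L1 + b2 * L2)"
    unfolding norm_Pair real_norm_def power2_abs by simp
qed

text \<open>
  Stated for numbers above the two norms, because the norms need not be attained; the triangle
  inequality follows by letting \<open>c\<close> and \<open>d\<close> decrease to them.
\<close>

lemma hilbert_op_add_less:
  assumes K: "K = \<real> \<or> K = UNIV" and X: "pointed_metric X" and F: "banach_vs K F"
    and S: "S \<in> hilbert_ops K X F" "hilbert_op_norm K X F S < c"
    and T: "T \<in> hilbert_ops K X F" "hilbert_op_norm K X F T < d"
  shows "pointwise_add X F S T \<in> hilbert_ops K X F"
    and "hilbert_op_norm K X F (pointwise_add X F S T) \<le> c + d"
proof -
  interpret F: normed_vs_loc K F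
    using F by (intro normed_vs_locI[OF K]) (simp add: banach_vs_def)
  obtain H1 :: "('a \<Rightarrow> complex) normed_space" and A1 B1 b1 L1 where
      S_fac: "bounded_factorization K X F S H1 A1 B1 b1 L1" and
      p1: "0 < b1" "0 < L1" "b1 * L1 < c"
    by (rule hilbert_op_norm_lessE[OF K F S])
  obtain H2 :: "('a \<Rightarrow> complex) normed_space" and A2 B2 b2 L2 where
      T_fac: "bounded_factorization K X F T H2 A2 B2 b2 L2" and
      p2: "0 < b2" "0 < L2" "b2 * L2 < d"
    by (rule hilbert_op_norm_lessE[OF K F T])
  interpret S: bounded_factorization K X F S H1 A1 B1 b1 L1
    by (rule S_fac)
  interpret T: bounded_factorization K X F T H2 A2 B2 b2 L2
    by (rule T_fac)
  have nH: "normed_vs K H1" "normed_vs K H2"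
    using S.hilbert T.hilbert by (auto simp: hilbert_vs_def banach_vs_def)
  interpret H1: normed_vs_loc K H1
    by (rule normed_vs_locI[OF K nH(1)])
  interpret H2: normed_vs_loc K H2
    by (rule normed_vs_locI[OF K nH(2)])
  define v w where "v = sqrt (b1 / L1)" and "w = sqrt (b2 / L2)"
  have vw: "0 < v" "0 < w"
    using p1 p2 by (auto simp: v_def w_def)
  define r where "r = sqrt (b1 * L1 + b2 * L2)"
  have r: "norm (v * L1, w * L2) = r" "norm (b1 / v, b2 / w) = r"
    unfolding r_def v_def w_def using balanced_weights p1 p2 by blast+
  interpret ST: bounded_factorization K X F "pointwise_add X F S T" "hilbert_sum v w H1 H2"
    "\<lambda>x. (A1 x, A2 x)" "\<lambda>p. B1 (fst p) \<oplus>\<^bsub>F\<^esub> B2 (snd p)" r r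
  proof unfold_locales
    show "hilbert_vs K (hilbert_sum v w H1 H2)"
      by (rule hilbert_vs_hilbert_sum[OF K S.hilbert T.hilbert vw])
    show "0 \<le> r"
      using p1 p2 by (auto simp: r_def)
    show "vdist (hilbert_sum v w H1 H2) (A1 x, A2 x) (A1 y, A2 y) \<le> r * mdist (fst X) x y"
      if xy: "x \<in> points X" "y \<in> points X" for x y
    proof -
      let ?m = "mdist (fst X) x y"
      have "vdist (hilbert_sum v w H1 H2) (A1 x, A2 x) (A1 y, A2 y)
          = norm (v * vdist H1 (A1 x) (A1 y), w * vdist H2 (A2 x) (A2 y))"
        using xy S.A_in T.A_in by (simp add: vdist_hilbert_sum[OF K nH vw])
      also have "\<dots> \<le> norm (v * (L1 * ?m), w * (L2 * ?m))"
        using xy S.A_lipschitz T.A_lipschitz vw Metric_space.nonneg[OF H1.metric_space]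
          Metric_space.nonneg[OF H2.metric_space]
        by (intro norm_Pair_mono mult_left_mono) auto
      also have "\<dots> = norm (?m *\<^sub>R (v * L1, w * L2))"
        by (simp add: algebra_simps)
      also have "\<dots> = r * ?m"
        unfolding norm_scaleR r by simp
      finally show ?thesis .
    qed
    show "vnorm F (B1 (fst p) \<oplus>\<^bsub>F\<^esub> B2 (snd p)) \<le> r * vnorm (hilbert_sum v w H1 H2) p"
      if "p \<in> carrier (hilbert_sum v w H1 H2)" for p
    proof -
      have p: "fst p \<in> carrier H1" "snd p \<in> carrier H2"
        using that by auto
      have "vnorm F (B1 (fst p) \<oplus>\<^bsub>F\<^esub> B2 (snd p)) \<le> b1 * vnorm H1 (fst p) + b2 * vnorm H2 (snd p)"
        using F.vnorm_triangle[OF S.B_in[OF p(1)] T.B_in[OF p(2)]]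
          S.B_bounded[OF p(1)] T.B_bounded[OF p(2)]
        by linarith
      \<comment> \<open>The weights cancel, and Cauchy-Schwarz in the plane separates the bounds from the norm of \<open>p\<close>.\<close>
      also have "\<dots> = inner (b1 / v, b2 / w) (v * vnorm H1 (fst p), w * vnorm H2 (snd p))"
        using vw by simp
      also have "\<dots> \<le> r * vnorm (hilbert_sum v w H1 H2) p"
        unfolding hilbert_sum_simps r(2)[symmetric] by (rule norm_cauchy_schwarz)
      finally show ?thesis .
    qed
    show "pointwise_add X F S T = (\<lambda>x\<in>points X. B1 (fst (A1 x, A2 x)) \<oplus>\<^bsub>F\<^esub> B2 (snd (A1 x, A2 x)))"
      by (auto simp: pointwise_add_def S.T_eq T.T_eq)
  qed (use S.A_in S.A_base T.A_in T.A_base S.B_in S.B_add S.B_smult T.B_in T.B_add T.B_smult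
        F.smult_r_distr in \<open>auto simp: F.M.a_ac\<close>)
  have "r * r \<le> c + d"
    using p1 p2 by (simp add: r_def add_pos_pos less_imp_le)
  then show "pointwise_add X F S T \<in> hilbert_ops K X F"
      "hilbert_op_norm K X F (pointwise_add X F S T) \<le> c + d"
    using ST.hilbert_op_norm_le[OF K X F] by auto
qed

lemma hilbert_op_compose_less:
  fixes X\<^sub>0 X :: "'a pointed"
  assumes K: "K = \<real> \<or> K = UNIV" and X0: "pointed_metric X\<^sub>0"
    and F: "banach_vs K F" and F0: "banach_vs K F\<^sub>0"
    and A: "A \<in> Lip X\<^sub>0 X" and B: "B \<in> bounded_ops K F F\<^sub>0"
    and T: "T \<in> hilbert_ops K X F" "hilbert_op_norm K X F T < c"
  shows "compose (points X\<^sub>0) B (compose (points X\<^sub>0) T A) \<in> hilbert_ops K X\<^sub>0 F\<^sub>0"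
    and "hilbert_op_norm K X\<^sub>0 F\<^sub>0 (compose (points X\<^sub>0) B (compose (points X\<^sub>0) T A))
      \<le> opnorm F F\<^sub>0 B * c * lip_const X\<^sub>0 X A"
proof -
  interpret F: normed_vs_loc K F
    using F by (intro normed_vs_locI[OF K]) (simp add: banach_vs_def)
  have nF0: "normed_vs K F\<^sub>0"
    using F0 by (simp add: banach_vs_def)
  obtain H :: "('a \<Rightarrow> complex) normed_space" and A1 B1 b L where
      T_fac: "bounded_factorization K X F T H A1 B1 b L" and bL: "0 < b" "0 < L" "b * L < c"
    by (rule hilbert_op_norm_lessE[OF K F T])
  interpret T: bounded_factorization K X F T H A1 B1 b L
    by (rule T_fac)
  let ?BTA = "compose (points X\<^sub>0) B (compose (points X\<^sub>0) T A)"
  let ?b = "opnorm F F\<^sub>0 B" and ?L = "lip_const X\<^sub>0 X A"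
  have b0: "0 \<le> ?b" and L0: "0 \<le> ?L"
    using F.opnorm_nonneg[OF nF0 B] lip_const_nonneg[OF A] by auto
  have AX: "A x \<in> points X" if "x \<in> points X\<^sub>0" for x
    using A that by (auto simp: Lip_def)
  interpret BTA: bounded_factorization K X\<^sub>0 F\<^sub>0 ?BTA H "\<lambda>x. A1 (A x)" "\<lambda>u. B (B1 u)"
    "?b * b" "L * ?L"
  proof unfold_locales
    show "hilbert_vs K H"
      by (rule T.hilbert)
    show "0 \<le> ?b * b" "0 \<le> L * ?L"
      using b0 L0 bL by auto
    show "vdist H (A1 (A x)) (A1 (A y)) \<le> L * ?L * mdist (fst X\<^sub>0) x y"
      if "x \<in> points X\<^sub>0" "y \<in> points X\<^sub>0" for x y
    proof -
      have "vdist H (A1 (A x)) (A1 (A y)) \<le> L * mdist (fst X) (A x) (A y)"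
        using AX that by (intro T.A_lipschitz) auto
      also have "\<dots> \<le> L * (?L * mdist (fst X\<^sub>0) x y)"
        using lip_const_bound[OF A that] T.L_nonneg by (rule mult_left_mono)
      finally show ?thesis
        by (simp add: mult.assoc)
    qed
    show "vnorm F\<^sub>0 (B (B1 u)) \<le> ?b * b * vnorm H u" if "u \<in> carrier H" for u
      using F.opnorm_bound[OF nF0 B T.B_in[OF that]] mult_left_mono[OF T.B_bounded[OF that] b0]
      by simp
    show "A1 (A (snd X\<^sub>0)) = \<zero>\<^bsub>H\<^esub>"
      using A T.A_base by (simp add: Lip_def)
    show "?BTA = (\<lambda>x\<in>points X\<^sub>0. B (B1 (A1 (A x))))"
      using AX by (auto simp: compose_def T.T_eq)
  qed (use T.A_in AX B T.B_in T.B_add T.B_smult in \<open>auto simp: bounded_ops_def\<close>)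
  have "?b * (b * L) * ?L \<le> ?b * c * ?L"
    using b0 L0 bL by (intro mult_right_mono mult_left_mono) auto
  then show "?BTA \<in> hilbert_ops K X\<^sub>0 F\<^sub>0"
      "hilbert_op_norm K X\<^sub>0 F\<^sub>0 ?BTA \<le> ?b * c * ?L"
    using BTA.hilbert_op_norm_le[OF K X0 F0] by (auto simp: mult.assoc)
qed

lemma hilbert_op_norm_nonneg:
  assumes K: "K = \<real> \<or> K = UNIV" and F: "banach_vs K F" and T: "T \<in> hilbert_ops K X F"
  shows "0 \<le> hilbert_op_norm K X F T"
proof (rule ccontr)
  assume "\<not> 0 \<le> hilbert_op_norm K X F T"
  then have "hilbert_op_norm K X F T < 0"
    by simp
  then obtain b L :: real where "0 < b" "0 < L" "b * L < 0"
    by (rule hilbert_op_norm_lessE[OF K F T])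
  then show False
    using mult_pos_pos[of b L] by linarith
qed

theorem proposition28:
  fixes K :: "complex set"
  assumes "K = \<real> \<or> K = UNIV"
  shows "strongly_lipschitz_normed_ideal K
           (hilbert_ops K :: ('a, 'b) operator_class) (hilbert_op_norm K)"
proof -
  note K = assms
  have add: "hilbert_op_norm K X F (pointwise_add X F S T)
      \<le> hilbert_op_norm K X F S + hilbert_op_norm K X F T"
    if X: "pointed_metric X" and F: "banach_vs K F"
      and S: "S \<in> hilbert_ops K X F" and T: "T \<in> hilbert_ops K X F"
    for X :: "'a pointed" and F :: "'b normed_space" and S T
  proof (rule field_le_epsilon)
    fix \<epsilon> :: real assume "0 < \<epsilon>"
    then have "hilbert_op_norm K X F S < hilbert_op_norm K X F S + \<epsilon> / 2"
        "hilbert_op_norm K X F T < hilbert_op_norm K X F T + \<epsilon> / 2"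
      by auto
    from hilbert_op_add_less(2)[OF K X F S this(1) T this(2)]
    show "hilbert_op_norm K X F (pointwise_add X F S T)
        \<le> hilbert_op_norm K X F S + hilbert_op_norm K X F T + \<epsilon>"
      by simp
  qed
  have comp: "hilbert_op_norm K X\<^sub>0 F\<^sub>0 (compose (points X\<^sub>0) B (compose (points X\<^sub>0) T A))
      \<le> opnorm F F\<^sub>0 B * hilbert_op_norm K X F T * lip_const X\<^sub>0 X A"
    if X0: "pointed_metric X\<^sub>0" and F: "banach_vs K F" and F0: "banach_vs K F\<^sub>0"
      and A: "A \<in> Lip X\<^sub>0 X" and T: "T \<in> hilbert_ops K X F" and B: "B \<in> bounded_ops K F F\<^sub>0"
    for X\<^sub>0 X :: "'a pointed" and F F\<^sub>0 :: "'b normed_space" and A T B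
  proof -
    let ?f = "\<lambda>c. opnorm F F\<^sub>0 B * c * lip_const X\<^sub>0 X A"
    let ?N = "hilbert_op_norm K X F T"
    \<comment> \<open>A limit in \<open>c\<close> instead of a division by \<open>\<parallel>B\<parallel> Lip(A)\<close>, which may be zero.\<close>
    have "(?f \<longlongrightarrow> ?f ?N) (at_right ?N)"
      by (intro tendsto_intros)
    moreover have "\<forall>\<^sub>F c in at_right ?N.
        hilbert_op_norm K X\<^sub>0 F\<^sub>0 (compose (points X\<^sub>0) B (compose (points X\<^sub>0) T A)) \<le> ?f c"
      using hilbert_op_compose_less(2)[OF K X0 F F0 A B T]
      by (auto simp: eventually_at_filter)
    ultimately show ?thesis
      by (rule tendsto_lowerbound) simp
  qed
  have ideal: "nonlinear_ideal K (hilbert_ops K :: ('a, 'b) operator_class)"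
    unfolding nonlinear_ideal_def
  proof (intro conjI allI impI ballI subsetI; elim conjE)
    fix X :: "'a pointed" and F :: "'b normed_space"
    assume XF: "pointed_metric X" "banach_vs K F"
    show "T \<in> Lip X (pointed_vs F)" if "T \<in> hilbert_ops K X F" for T
      using that by (simp add: hilbert_ops_def)
    show "rank_one X F g e \<in> hilbert_ops K X F" if "g \<in> lip_dual K X" "e \<in> carrier F" for g e
      by (rule hilbert_op_rank_one(1)[OF K XF that])
    show "pointwise_add X F S T \<in> hilbert_ops K X F"
      if "S \<in> hilbert_ops K X F" "T \<in> hilbert_ops K X F" for S T
      by (rule hilbert_op_add_less(1)[OF K XF that(1) less_add_one that(2) less_add_one])
  next
    fix X\<^sub>0 X :: "'a pointed" and F F\<^sub>0 :: "'b normed_space" and A T B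
    assume "pointed_metric X\<^sub>0" "pointed_metric X" "banach_vs K F" "banach_vs K F\<^sub>0"
      and "A \<in> Lip X\<^sub>0 X" "T \<in> hilbert_ops K X F" "B \<in> bounded_ops K F F\<^sub>0"
    then show "compose (points X\<^sub>0) B (compose (points X\<^sub>0) T A) \<in> hilbert_ops K X\<^sub>0 F\<^sub>0"
      by (intro hilbert_op_compose_less(1)[OF K _ _ _ _ _ _ less_add_one])
  qed
  show ?thesis
    unfolding strongly_lipschitz_normed_ideal_def
  proof (intro conjI allI impI ballI; (elim conjE)?)
    fix X :: "'a pointed" and F :: "'b normed_space"
    assume XF: "pointed_metric X" "banach_vs K F"
    show "0 \<le> hilbert_op_norm K X F T" if "T \<in> hilbert_ops K X F" for T
      by (rule hilbert_op_norm_nonneg[OF K XF(2) that])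
    show "hilbert_op_norm K X F (rank_one X F g e) \<le> lip_const X (pointed_scalars K) g * vnorm F e"
      if "g \<in> lip_dual K X" "e \<in> carrier F" for g e
      by (rule hilbert_op_rank_one(2)[OF K XF that])
  qed (fact ideal | rule add comp; assumption)+
qed

end
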